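(* Let $a\ge 1$ and $k\ge 3$ be integers. Then there is $n_0=n_0(a,k)$ such that for every $n\ge n_0$ with $k\mid n$ the $(a:a)$ Maker-Breaker $S_k$-factor game $\mathcal{S}_{k,n}$ on $E(K_n)$ satisfies $$\tau_{\mathcal{S}_{k,n}}(a:a)\le\begin{cases}\left\lceil \frac{(k-1)n}{ka}\right\rceil, & \text{if } a\nmid \frac{(k-1)n}{k},\\ \frac{(k-1)n}{ka}+1, & \text{otherwise.}\end{cases}$$
   Context: In the $(a:a)$ Maker-Breaker game with board $X=E(K_n)$ (the edge set of the complete graph on $n$ vertices) and family of winning sets $\mathcal{F}\subseteq 2^X$, Breaker and Maker alternately claim $a$ previously unclaimed elements of $X$ per move (fewer if fewer remain), and Breaker moves first. Maker wins at the moment she has claimed all elements of some $F\in\mathcal{F}$ (this may happen before she has used all $a$ steps of her move); if she has not done so by the time all of $X$ is claimed, Breaker wins. $\tau_{\mathcal{F}}(a:a)$ denotes the least number of moves $t$ such that Maker has a strategy to win the $(a:a)$ game $\mathcal{F}$ within $t$ of her moves, against any strategy of Breaker ($\tau_{\mathcal F}(a:a)=\infty$ if Breaker has a winning strategy). $S_k$ denotes the star with $k-1$ leaves (so $k$ vertices). For $k\mid n$, in the $S_k$-factor game $\mathcal{S}_{k,n}$ the winning sets are the edge sets of all $S_k$-factors of $K_n$, i.e. of all collections of $n/k$ pairwise vertex-disjoint copies of $S_k$ in $K_n$ (covering all $n$ vertices). *)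

theory Defs
  imports Complex_Main "HOL-Library.Extended_Nat" "HOL-Library.Ramsey"
begin

text \<open>
  Maker-Breaker games. A play is recorded as the list of the sets claimed in the successive
  moves, oldest first. Breaker moves first, so the moves at even positions (counting from 0)
  are Breaker's and those at odd positions are Maker's. A strategy is a function from
  histories to moves.
\<close>

definition free_elements :: "'e set \<Rightarrow> 'e set list \<Rightarrow> 'e set" where
  "free_elements X h = X - \<Union> (set h)"

text \<open>
  A move claims exactly \<open>a\<close> free elements, or all of them if fewer than \<open>a\<close> remain
  (the board \<open>X\<close> is finite). If Maker completes a winning set part-way through a move, she
  has won, and the remaining steps of that move are irrelevant; so neither these steps nor
  the moves recorded after a win affect the number of moves in which Maker wins.
\<close>

definition legal_move :: "nat \<Rightarrow> 'e set \<Rightarrow> 'e set list \<Rightarrow> 'e set \<Rightarrow> bool" where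
  "legal_move a X h T \<longleftrightarrow>
     T \<subseteq> free_elements X h \<and> card T = min a (card (free_elements X h))"

type_synonym 'e strategy = "'e set list \<Rightarrow> 'e set"

definition legal_strategy :: "nat \<Rightarrow> 'e set \<Rightarrow> 'e strategy \<Rightarrow> bool" where
  "legal_strategy a X s \<longleftrightarrow> (\<forall>h. legal_move a X h (s h))"

primrec play :: "'e strategy \<Rightarrow> 'e strategy \<Rightarrow> nat \<Rightarrow> 'e set list" where
  "play breaker maker 0 = []"
| "play breaker maker (Suc i) =
     (let h = play breaker maker i
      in h @ [if even i then breaker h else maker h])"

definition maker_claimed :: "'e set list \<Rightarrow> 'e set" where
  "maker_claimed h = (\<Union>i\<in>{i. i < length h \<and> odd i}. h ! i)"

text \<open>The first \<open>2 * t\<close> moves of a play contain exactly \<open>t\<close> moves of Maker.\<close>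

definition maker_wins_within ::
  "nat \<Rightarrow> 'e set \<Rightarrow> 'e set set \<Rightarrow> 'e strategy \<Rightarrow> nat \<Rightarrow> bool" where
  "maker_wins_within a X F maker t \<longleftrightarrow>
     (\<forall>breaker. legal_strategy a X breaker \<longrightarrow>
        (\<exists>W\<in>F. W \<subseteq> maker_claimed (play breaker maker (2 * t))))"

text \<open>The infimum is a minimum if the set is nonempty, and \<open>\<infinity>\<close> otherwise.\<close>

definition mb_tau :: "nat \<Rightarrow> 'e set \<Rightarrow> 'e set set \<Rightarrow> enat" where
  "mb_tau a X F =
     Inf {enat t | t. \<exists>maker. legal_strategy a X maker \<and> maker_wins_within a X F maker t}"

text \<open>
  The complete graph \<open>K\<^sub>n\<close> has vertex set \<open>{..<n}\<close>; an edge is a two-element set of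
  vertices. A graph is the pair of its vertex set and its edge set.
\<close>

definition complete_edges :: "nat \<Rightarrow> nat set set" where
  "complete_edges n = nsets {..<n} 2"

text \<open>The index \<open>k\<close> of a star counts its vertices: a centre \<open>c\<close> and \<open>k - 1\<close> leaves.\<close>

definition is_star :: "nat \<Rightarrow> 'v set \<times> 'v set set \<Rightarrow> bool" where
  "is_star k G \<longleftrightarrow>
     (\<exists>c L. finite L \<and> c \<notin> L \<and> card L = k - 1 \<and>
            fst G = insert c L \<and> snd G = (\<lambda>v. {c, v}) ` L)"

definition is_star_factor :: "nat \<Rightarrow> nat \<Rightarrow> (nat set \<times> nat set set) set \<Rightarrow> bool" where
  "is_star_factor k n \<C> \<longleftrightarrow>
     finite \<C> \<and> card \<C> = n div k \<and>
     (\<forall>G\<in>\<C>. is_star k G \<and> fst G \<subseteq> {..<n} \<and> snd G \<subseteq> complete_edges n) \<and>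
     pairwise (\<lambda>G H. disjnt (fst G) (fst H)) \<C> \<and>
     (\<Union>G\<in>\<C>. fst G) = {..<n}"

definition star_factor_game :: "nat \<Rightarrow> nat \<Rightarrow> nat set set set" where
  "star_factor_game k n = {(\<Union>G\<in>\<C>. snd G) | \<C>. is_star_factor k n \<C>}"

end

theory Submission
  imports Defs
begin

text \<open>
  In both cases of the bound Maker has \<open>N div a + 1\<close> moves, where \<open>N = (k - 1) * q\<close> and
  \<open>q = n div k\<close>, so she may waste at least one edge. She fixes \<open>q\<close> centres and assigns the
  remaining \<open>N\<close> vertices to them as leaves, at most \<open>k - 1\<close> to each centre. Let \<open>W\<close> be the
  set of unassigned leaves, \<open>C\<close> the set of centres that still lack leaves, and consider
  Breaker's edges between \<open>C\<close> and \<open>W\<close>.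

  As long as many centres lack at least two leaves, she assigns each leaf that Breaker touches
  to such a centre, so after each of her moves Breaker has no edge between \<open>C\<close> and \<open>W\<close>. Afterwards
  she lowers a potential, which counts these edges, the excess \<open>card W - card C\<close>, and the vertices
  of \<open>C \<union> W\<close> of high Breaker degree. Each of her edges removes a leaf and, once every centre in
  \<open>C\<close> lacks exactly one leaf, also a centre, and so lowers the potential by two, whereas an edge of
  Breaker raises it by one. When \<open>r \<le> a\<close> leaves are left, with \<open>1 \<le> r\<close>, the potential is zero:
  there are \<open>r\<close> centres in \<open>C\<close>, no Breaker edge joins them to \<open>W\<close>, and all Breaker degrees in
  \<open>C \<union> W\<close> are small.

  Breaker's next \<open>a\<close> edges either satisfy \<open>a < 2 * r\<close> and leave a matching of size \<open>r - 1\<close>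
  between \<open>C\<close> and \<open>W\<close>, or \<open>2 * r \<le> a\<close>. A leaf \<open>w\<close> and a centre \<open>c\<close> can also be served by two
  edges: join \<open>w\<close> to a full centre, and one of the former leaves of that centre to \<open>c\<close>.
\<close>

section \<open>Steps in bipartite graphs\<close>

definition edges_between :: "('v \<times> 'v) set \<Rightarrow> 'v set \<Rightarrow> 'v set \<Rightarrow> nat" where
  "edges_between R C W = card (R \<inter> C \<times> W)"

lemma edges_between_mono:
  assumes "finite R" "C' \<subseteq> C" "W' \<subseteq> W"
  shows "edges_between R C' W' \<le> edges_between R C W"
  unfolding edges_between_def using assms by (intro card_mono) auto

lemma edges_between_Un:
  assumes "finite T"
  shows "edges_between (R \<union> T) C W \<le> edges_between R C W + card T"
proof -
  have "card ((R \<union> T) \<inter> C \<times> W) \<le> card (R \<inter> C \<times> W) + card (T \<inter> C \<times> W)"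
    by (metis Int_Un_distrib2 card_Un_le)
  also have "card (T \<inter> C \<times> W) \<le> card T"
    using assms by (intro card_mono) auto
  finally show ?thesis
    by (simp add: edges_between_def)
qed

lemma nonadjacent_left:
  assumes "finite R" "w \<in> W" "edges_between R C W < card C"
  obtains c where "c \<in> C" "(c, w) \<notin> R"
proof -
  have "\<not> (\<lambda>c. (c, w)) ` C \<subseteq> R \<inter> C \<times> W"
  proof
    assume "(\<lambda>c. (c, w)) ` C \<subseteq> R \<inter> C \<times> W"
    then have "card ((\<lambda>c. (c, w)) ` C) \<le> edges_between R C W"
      unfolding edges_between_def using assms(1) by (intro card_mono) auto
    moreover have "card ((\<lambda>c. (c, w)) ` C) = card C"
      by (intro card_image) (auto simp: inj_on_def)
    ultimately show False
      using assms(3) by simp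
  qed
  then show thesis
    using assms(2) that by auto
qed

lemma nonadjacent_right:
  assumes "finite R" "c \<in> C" "edges_between R C W < card W"
  obtains w where "w \<in> W" "(c, w) \<notin> R"
proof -
  have "\<not> (\<lambda>w. (c, w)) ` W \<subseteq> R \<inter> C \<times> W"
  proof
    assume "(\<lambda>w. (c, w)) ` W \<subseteq> R \<inter> C \<times> W"
    then have "card ((\<lambda>w. (c, w)) ` W) \<le> edges_between R C W"
      unfolding edges_between_def using assms(1) by (intro card_mono) auto
    moreover have "card ((\<lambda>w. (c, w)) ` W) = card W"
      by (intro card_image) (auto simp: inj_on_def)
    ultimately show False
      using assms(3) by simp
  qed
  then show thesis
    using assms(2) that by auto
qed

lemma edges_between_remove:
  assumes "finite R" "P \<subseteq> R \<inter> C \<times> W" "\<And>x y. (x, y) \<in> P \<Longrightarrow> x = c \<or> y = w"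
  shows "edges_between R (C - {c}) (W - {w}) + card P \<le> edges_between R C W"
proof -
  have "R \<inter> (C - {c}) \<times> (W - {w}) \<subseteq> R \<inter> C \<times> W - P"
    using assms(3) by auto
  then have "card (R \<inter> (C - {c}) \<times> (W - {w})) \<le> card (R \<inter> C \<times> W - P)"
    using assms(1) by (intro card_mono) auto
  also have "\<dots> = card (R \<inter> C \<times> W) - card P"
    using assms(1,2) by (intro card_Diff_subset) (auto intro: finite_subset)
  finally show ?thesis
    using card_mono[OF _ assms(2)] assms(1) by (simp add: edges_between_def)
qed

lemma edges_between_remove1:
  assumes "finite R" "(x, y) \<in> R" "x \<in> C" "y \<in> W" "x = c \<or> y = w"
  shows "edges_between R (C - {c}) (W - {w}) + 1 \<le> edges_between R C W"
  using edges_between_remove[of R "{(x, y)}" C W c w] assms by auto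

lemma edges_between_remove2:
  assumes "finite R" "(x, y) \<in> R" "x \<in> C" "y \<in> W" "x = c \<or> y = w"
    "(x', y') \<in> R" "x' \<in> C" "y' \<in> W" "x' = c \<or> y' = w" "(x, y) \<noteq> (x', y')"
  shows "edges_between R (C - {c}) (W - {w}) + 2 \<le> edges_between R C W"
  using edges_between_remove[of R "{(x, y), (x', y')}" C W c w] assms by auto

text \<open>Subtraction is truncated, so two edges must be destroyed, or all if there are fewer. Two
  edges at a common vertex vanish with it, and by the edge count this vertex has a non-neighbour to
  be deleted along with it. Disjoint edges \<open>(x, y)\<close> and \<open>(x', y')\<close> vanish
  with \<open>x\<close> and \<open>y'\<close> if these are non-adjacent; otherwise \<open>x\<close>
  carries two edges.\<close>

lemma double_step_edges:
  assumes "finite R" "finite C" "finite W" and cW: "card C = card W"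
    and e: "edges_between R C W < card W"
  shows "\<exists>c\<in>C. \<exists>w\<in>W. (c, w) \<notin> R \<and>
    edges_between R (C - {c}) (W - {w}) \<le> edges_between R C W - 2"
proof -
  let ?E = "R \<inter> C \<times> W"
  have finE: "finite ?E"
    using assms(1) by simp
  consider (none) "?E = {}" | (one) x y where "?E = {(x, y)}"
    | (two) x y x' y' where "(x, y) \<in> ?E" "(x', y') \<in> ?E" "(x, y) \<noteq> (x', y')"
    by (metis (no_types, lifting) insertI1 is_singletonI' is_singletonE surj_pair)
  then show ?thesis
  proof cases
    case none
    obtain w where w: "w \<in> W"
      using e by fastforce
    with nonadjacent_left[OF assms(1) w, of C] e cW obtain c where "c \<in> C" "(c, w) \<notin> R"
      by auto
    moreover have "edges_between R (C - {c}) (W - {w}) \<le> edges_between R C W"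
      using assms(1) by (intro edges_between_mono) auto
    ultimately show ?thesis
      using w none by (auto simp: edges_between_def)
  next
    case one
    then have xy: "x \<in> C" "y \<in> W" "(x, y) \<in> R"
      by auto
    obtain c where c: "c \<in> C" "(c, y) \<notin> R"
      using nonadjacent_left[OF assms(1) xy(2), of C] e cW by auto
    have "edges_between R (C - {c}) (W - {y}) + 1 \<le> edges_between R C W"
      using xy assms(1) by (intro edges_between_remove1) auto
    moreover have "edges_between R C W = 1"
      using one by (simp add: edges_between_def)
    ultimately show ?thesis
      using c xy by (intro bexI[of _ c] bexI[of _ y]) auto
  next
    case two
    show ?thesis
    proof (cases "y = y'")
      case True
      obtain c where c: "c \<in> C" "(c, y) \<notin> R"
        using nonadjacent_left[OF assms(1), of y W C] e cW two by auto
      have "edges_between R (C - {c}) (W - {y}) + 2 \<le> edges_between R C W"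
        using two True assms(1) by (intro edges_between_remove2[of _ x y _ _ _ _ x' y']) auto
      then show ?thesis
        using c two by (intro bexI[of _ c] bexI[of _ y]) auto
    next
      case ny: False
      show ?thesis
      proof (cases "(x, y') \<in> R")
        case True
        obtain w where w: "w \<in> W" "(x, w) \<notin> R"
          using nonadjacent_right[OF assms(1), of x C W] e two by auto
        have "edges_between R (C - {x}) (W - {w}) + 2 \<le> edges_between R C W"
          using two True ny assms(1)
          by (intro edges_between_remove2[of _ x y _ _ _ _ x y']) auto
        then show ?thesis
          using w two by (intro bexI[of _ x] bexI[of _ w]) auto
      next
        case False
        have "edges_between R (C - {x}) (W - {y'}) + 2 \<le> edges_between R C W"
          using two assms(1)
          by (intro edges_between_remove2[of _ x y _ _ _ _ x' y']) auto
        then show ?thesis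
          using False two by (intro bexI[of _ x] bexI[of _ y']) auto
      qed
    qed
  qed
qed

text \<open>A vertex of \<open>Z\<close> has weight 2, so deleting one already gives the required
  drop; if none is left, two edges have to go.\<close>

lemma double_step:
  assumes "finite R" "finite C" "finite W" "C \<inter> W = {}" and cW: "card C = card W"
    and e: "edges_between R C W < card W"
  shows "\<exists>c\<in>C. \<exists>w\<in>W. (c, w) \<notin> R \<and>
    edges_between R (C - {c}) (W - {w}) + 2 * card (Z \<inter> ((C - {c}) \<union> (W - {w})))
      \<le> edges_between R C W + 2 * card (Z \<inter> (C \<union> W)) - 2"
proof (cases "Z \<inter> (C \<union> W) = {}")
  case True
  then have "Z \<inter> ((C - {c}) \<union> (W - {w})) = {}" for c w
    by auto
  then show ?thesis
    using double_step_edges[OF assms(1-3) cW e] True by auto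
next
  case False
  then obtain z where z: "z \<in> Z" "z \<in> C \<or> z \<in> W"
    by auto
  obtain c w where cw: "c \<in> C" "w \<in> W" "(c, w) \<notin> R" "z = c \<or> z = w"
    using z nonadjacent_left[OF assms(1), of z W C] nonadjacent_right[OF assms(1), of z C W]
      e cW by metis
  have "card (Z \<inter> ((C - {c}) \<union> (W - {w}))) \<le> card (Z \<inter> (C \<union> W) - {z})"
    using cw assms by (intro card_mono) auto
  also have "\<dots> = card (Z \<inter> (C \<union> W)) - 1"
    using z by (intro card_Diff_singleton) auto
  finally have "card (Z \<inter> ((C - {c}) \<union> (W - {w}))) \<le> card (Z \<inter> (C \<union> W)) - 1" .
  moreover have "card (Z \<inter> (C \<union> W)) > 0"
    using False assms by (auto simp: card_gt_0_iff)
  moreover have "edges_between R (C - {c}) (W - {w}) \<le> edges_between R C W"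
    using assms(1) by (intro edges_between_mono) auto
  ultimately show ?thesis
    using cw by (intro bexI[of _ c] bexI[of _ w]) auto
qed

text \<open>The bound \<open>2 * card W\<close> is the invariant under which a greedy matching of
  size \<open>card W - 1\<close> never gets stuck. Destroying one edge per step preserves it, except
  when there are exactly \<open>2 * card W - 1\<close> edges: then two must be destroyed.\<close>

lemma matching_step:
  assumes "finite R" "finite C" "finite W" and cW: "card C = card W" and "card W \<ge> 2"
    and e: "edges_between R C W < 2 * card W"
  shows "\<exists>c\<in>C. \<exists>w\<in>W. (c, w) \<notin> R \<and>
    edges_between R (C - {c}) (W - {w}) < 2 * (card W - 1)"
proof -
  let ?E = "R \<inter> C \<times> W"
  have free: "\<exists>c\<in>C. \<exists>w\<in>W. (c, w) \<notin> R"
  proof (rule ccontr)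
    assume "\<not> ?thesis"
    then have "?E = C \<times> W"
      by auto
    then have "edges_between R C W = card W * card W"
      using cW by (simp add: edges_between_def card_cartesian_product)
    moreover have "2 * card W \<le> card W * card W"
      using assms(5) by simp
    ultimately show False
      using e by simp
  qed
  have kill1: "\<exists>c\<in>C. \<exists>w\<in>W. (c, w) \<notin> R \<and>
    edges_between R (C - {c}) (W - {w}) \<le> edges_between R C W - 1"
  proof (cases "?E = {}")
    case True
    have "edges_between R (C - {c}) (W - {w}) \<le> edges_between R C W" for c w
      using assms(1) by (intro edges_between_mono) auto
    then show ?thesis
      using free True by (auto simp: edges_between_def)
  next
    case False
    then obtain x y where xy: "(x, y) \<in> R" "x \<in> C" "y \<in> W"
      by auto
    show ?thesis
    proof (cases "\<exists>c\<in>C. (c, y) \<notin> R")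
      case True
      then obtain c where c: "c \<in> C" "(c, y) \<notin> R"
        by auto
      have "edges_between R (C - {c}) (W - {y}) + 1 \<le> edges_between R C W"
        using xy assms(1) by (intro edges_between_remove1) auto
      then show ?thesis
        using c xy by (intro bexI[of _ c] bexI[of _ y]) auto
    next
      \<comment> \<open>Every centre is adjacent to \<open>y\<close>, so the centre \<open>c\<close>
        of any free pair takes the edge \<open>(c, y)\<close> along.\<close>
      case full: False
      obtain c w where cw: "c \<in> C" "w \<in> W" "(c, w) \<notin> R"
        using free by auto
      have "edges_between R (C - {c}) (W - {w}) + 1 \<le> edges_between R C W"
        using full cw xy assms(1) by (intro edges_between_remove1[of _ c y]) auto
      then show ?thesis
        using cw by (intro bexI[of _ c] bexI[of _ w]) auto
    qed
  qed
  show ?thesis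
  proof (cases "edges_between R C W + 1 = 2 * card W")
    case False
    then have "edges_between R C W - 1 < 2 * (card W - 1)"
      using e assms(5) by linarith
    then show ?thesis
      using kill1 by (meson le_less_trans)
  next
    case True
    \<comment> \<open>The tight case: \<open>2 * card W - 1 > card W\<close>, so two edges share a
      leaf \<open>y\<close>.\<close>
    have "\<not> inj_on snd ?E"
    proof
      assume "inj_on snd ?E"
      then have "card ?E \<le> card W"
        using assms(3) by (intro card_inj_on_le[of snd]) auto
      then show False
        using True assms(5) by (simp add: edges_between_def)
    qed
    then obtain x x' y where xy: "(x, y) \<in> R" "(x', y) \<in> R" "x \<noteq> x'" "x \<in> C" "x' \<in> C" "y \<in> W"
      by (auto simp: inj_on_def) blast
    show ?thesis
    proof (cases "\<exists>c\<in>C. (c, y) \<notin> R")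
      case ex: True
      then obtain c where c: "c \<in> C" "(c, y) \<notin> R"
        by auto
      have "edges_between R (C - {c}) (W - {y}) + 2 \<le> edges_between R C W"
        using xy assms(1) by (intro edges_between_remove2[of _ x y _ _ _ _ x' y]) auto
      then show ?thesis
        using c xy True by (intro bexI[of _ c] bexI[of _ y]) auto
    next
      \<comment> \<open>\<open>y\<close> uses up \<open>card C\<close> edges, so exactly
        \<open>card C - 1 > 0\<close> edges avoid it. One of them, \<open>(u, v)\<close>, vanishes
        with \<open>v\<close>, and a non-neighbour \<open>c\<close> of \<open>v\<close> takes
        \<open>(c, y)\<close> along.\<close>
      case full: False
      have E_eq: "?E = C \<times> {y} \<union> R \<inter> C \<times> (W - {y})"
        using full xy by auto
      have "card ?E = card (C \<times> {y}) + edges_between R C (W - {y})"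
        unfolding edges_between_def
        by (subst E_eq, rule card_Un_disjoint) (use assms in auto)
      then have rest: "edges_between R C (W - {y}) + 1 = card C"
        using True cW by (simp add: edges_between_def card_cartesian_product)
      then have "edges_between R C (W - {y}) \<noteq> 0"
        using assms(5) cW by linarith
      then have "R \<inter> C \<times> (W - {y}) \<noteq> {}"
        by (metis card.empty edges_between_def)
      then obtain u v where uv: "(u, v) \<in> R" "u \<in> C" "v \<in> W - {y}"
        by auto
      obtain c where c: "c \<in> C" "(c, v) \<notin> R"
        using nonadjacent_left[OF assms(1) uv(3), of C] rest by auto
      have "edges_between R (C - {c}) (W - {v}) + 2 \<le> edges_between R C W"
        using c uv xy full assms(1) by (intro edges_between_remove2[of _ u v _ _ _ _ c y]) auto
      then show ?thesis
        using c uv True by (intro bexI[of _ c] bexI[of _ v]) auto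
    qed
  qed
qed

section \<open>Degrees and the number of vertices of high degree\<close>

definition degree :: "('v \<times> 'v) set \<Rightarrow> 'v \<Rightarrow> nat" where
  "degree R v = card {p \<in> R. fst p = v \<or> snd p = v}"

lemma degree_Un:
  assumes "finite T"
  shows "degree (R \<union> T) v \<le> degree R v + card T"
proof -
  have "{p \<in> R \<union> T. fst p = v \<or> snd p = v} =
      {p \<in> R. fst p = v \<or> snd p = v} \<union> {p \<in> T. fst p = v \<or> snd p = v}"
    by auto
  then have "degree (R \<union> T) v \<le> degree R v + card {p \<in> T. fst p = v \<or> snd p = v}"
    by (simp add: degree_def card_Un_le)
  also have "card {p \<in> T. fst p = v \<or> snd p = v} \<le> card T"
    using assms by (intro card_mono) auto
  finally show ?thesis
    by simp
qed

lemma sum_degree_le: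
  assumes "finite R" "finite V"
  shows "(\<Sum>v\<in>V. degree R v) \<le> 2 * card R"
proof -
  have "(\<Sum>v\<in>V. degree R v) = card (SIGMA v:V. {p \<in> R. fst p = v \<or> snd p = v})"
    unfolding degree_def using assms by (subst card_SigmaI) auto
  also have "\<dots> \<le> card ((\<lambda>p. (fst p, p)) ` R \<union> (\<lambda>p. (snd p, p)) ` R)"
    using assms by (intro card_mono) auto
  also have "\<dots> \<le> card ((\<lambda>p. (fst p, p)) ` R) + card ((\<lambda>p. (snd p, p)) ` R)"
    by (rule card_Un_le)
  also have "\<dots> \<le> 2 * card R"
    unfolding mult_2 by (intro add_mono card_image_le assms(1))
  finally show ?thesis .
qed

text \<open>Markov's inequality for the degree sum.\<close>

lemma card_high_degree:
  assumes "finite R" "finite V"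
  shows "\<theta> * card {v \<in> V. \<theta> \<le> degree R v} \<le> 2 * card R"
proof -
  have "\<theta> * card {v \<in> V. \<theta> \<le> degree R v} \<le> (\<Sum>v\<in>{v \<in> V. \<theta> \<le> degree R v}. degree R v)"
    using sum_bounded_below[of "{v \<in> V. \<theta> \<le> degree R v}" \<theta> "degree R"] by (simp add: mult.commute)
  also have "\<dots> \<le> 2 * card R"
    using assms by (intro sum_degree_le) auto
  finally show ?thesis .
qed

text \<open>An assignment is a partial map from leaves to centres, so no leaf can have two centres;
  fibres are the leaf sets of the stars under construction.\<close>

definition fibre :: "('v \<Rightarrow> 'v option) \<Rightarrow> 'v \<Rightarrow> 'v set" where
  "fibre f c = {l. f l = Some c}"

definition pairs_of :: "('v \<Rightarrow> 'v option) \<Rightarrow> ('v \<times> 'v) set" where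
  "pairs_of f = {(c, l). f l = Some c}"

lemma fibre_upd:
  "f w = None \<Longrightarrow> fibre (f(w \<mapsto> c)) x = (if x = c then insert w (fibre f x) else fibre f x)"
  by (auto simp: fibre_def)

section \<open>Partial assignments of leaves to centres\<close>

text \<open>Here \<open>d\<close> stands for \<open>k - 1\<close>. By \<open>card_L0\<close>,
  assigning all leaves with at most \<open>d\<close> per centre fills every centre.\<close>

locale star_pairs =
  fixes a d :: nat and C0 L0 :: "'v set"
  assumes finite_C0: "finite C0" and finite_L0: "finite L0" and disjoint: "C0 \<inter> L0 = {}"
    and card_L0: "card L0 = d * card C0" and d_ge_2: "2 \<le> d" and a_pos: "1 \<le> a"
begin

definition assignment :: "('v \<Rightarrow> 'v option) \<Rightarrow> bool" where
  "assignment f \<longleftrightarrow> dom f \<subseteq> L0 \<and> ran f \<subseteq> C0 \<and> (\<forall>c. card (fibre f c) \<le> d)"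

definition open_leaves :: "('v \<Rightarrow> 'v option) \<Rightarrow> 'v set" where
  "open_leaves f = L0 - dom f"

definition open_centres :: "('v \<Rightarrow> 'v option) \<Rightarrow> 'v set" where
  "open_centres f = {c \<in> C0. card (fibre f c) < d}"

lemma finite_open_leaves [simp]: "finite (open_leaves f)"
  using finite_L0 by (simp add: open_leaves_def)

lemma finite_open_centres [simp]: "finite (open_centres f)"
  using finite_C0 by (simp add: open_centres_def)

lemma open_leaves_subset: "open_leaves f \<subseteq> L0"
  by (auto simp: open_leaves_def)

lemma open_centres_subset: "open_centres f \<subseteq> C0"
  by (auto simp: open_centres_def)

lemma finite_fibre: "assignment f \<Longrightarrow> finite (fibre f c)"
  by (rule finite_subset[OF _ finite_L0]) (auto simp: assignment_def fibre_def)

lemma finite_pairs_of: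
  assumes "assignment f"
  shows "finite (pairs_of f)"
proof (rule finite_subset)
  show "pairs_of f \<subseteq> C0 \<times> L0"
    using assms by (auto simp: assignment_def pairs_of_def intro: ranI)
qed (use finite_C0 finite_L0 in auto)

text \<open>Double counting: initially the centres have room for
  \<open>d * card C0 = card L0\<close> leaves, and each assigned leaf takes one place.\<close>

lemma sum_capacities:
  assumes "assignment f"
  shows "(\<Sum>c\<in>open_centres f. d - card (fibre f c)) = card (open_leaves f)"
proof -
  have dom_eq: "dom f = (\<Union>c\<in>C0. fibre f c)"
    using assms by (fastforce simp: assignment_def fibre_def dom_def ran_def)
  have "card (dom f) = (\<Sum>c\<in>C0. card (fibre f c))"
    unfolding dom_eq using finite_C0 finite_fibre[OF assms]
    by (intro card_UN_disjoint) (auto simp: fibre_def)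
  moreover have "(\<Sum>c\<in>C0. d - card (fibre f c)) + (\<Sum>c\<in>C0. card (fibre f c)) = d * card C0"
    using assms by (simp add: sum.distrib[symmetric] assignment_def)
  moreover have "card (open_leaves f) = card L0 - card (dom f)"
    unfolding open_leaves_def using assms finite_L0
    by (intro card_Diff_subset) (auto simp: assignment_def intro: finite_subset)
  moreover have "(\<Sum>c\<in>open_centres f. d - card (fibre f c)) = (\<Sum>c\<in>C0. d - card (fibre f c))"
    using finite_C0 by (intro sum.mono_neutral_left) (auto simp: open_centres_def)
  ultimately show ?thesis
    using card_L0 by linarith
qed

lemma card_open_centres_le:
  assumes "assignment f"
  shows "card (open_centres f) \<le> card (open_leaves f)"
proof -
  have "(\<Sum>c\<in>open_centres f. 1) \<le> (\<Sum>c\<in>open_centres f. d - card (fibre f c))"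
    by (intro sum_mono) (auto simp: open_centres_def)
  then show ?thesis
    using sum_capacities[OF assms] by simp
qed

lemma capacity_one:
  assumes "assignment f" "card (open_centres f) = card (open_leaves f)" "c \<in> open_centres f"
  shows "Suc (card (fibre f c)) = d"
proof (rule ccontr)
  assume "Suc (card (fibre f c)) \<noteq> d"
  then have "(\<Sum>c\<in>open_centres f. 1) < (\<Sum>c\<in>open_centres f. d - card (fibre f c))"
    using assms(3)
    by (intro sum_strict_mono_ex1 finite_open_centres)
      (auto simp: open_centres_def intro!: bexI[of _ c])
  then show False
    using sum_capacities[OF assms(1)] assms(2) by simp
qed

definition roomy_centres :: "('v \<Rightarrow> 'v option) \<Rightarrow> 'v set" where
  "roomy_centres f = {c \<in> C0. Suc (card (fibre f c)) < d}"

lemma roomy_subset: "roomy_centres f \<subseteq> open_centres f"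
  by (auto simp: roomy_centres_def open_centres_def)

lemma card_open_leaves_le:
  assumes "assignment f"
  shows "card (open_leaves f) \<le> card (open_centres f) + (d - 1) * card (roomy_centres f)"
proof -
  have "card (open_leaves f) = (\<Sum>c\<in>open_centres f. d - card (fibre f c))"
    using sum_capacities[OF assms] by simp
  also have "\<dots> \<le> (\<Sum>c\<in>open_centres f. 1 + (if c \<in> roomy_centres f then d - 1 else 0))"
    by (intro sum_mono) (auto simp: open_centres_def roomy_centres_def)
  also have "\<dots> = card (open_centres f) + (\<Sum>c\<in>open_centres f. if c \<in> roomy_centres f then d - 1 else 0)"
    by (subst sum.distrib) simp
  also have "(\<Sum>c\<in>open_centres f. if c \<in> roomy_centres f then d - 1 else 0) =
      (d - 1) * card (roomy_centres f)"
    using roomy_subset[of f] by (simp add: sum.If_cases Int_absorb1)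
  finally show ?thesis .
qed

text \<open>Models at most \<open>i\<close> pairs that Maker claims within one round, while
  \<open>R\<close> is fixed. Only new pairs are counted and must avoid \<open>R\<close>, since those
  of \<open>f\<close> are already hers. \<open>g\<close> need not extend \<open>f\<close>, because a
  swap gives up an old pair.\<close>

definition reachable :: "('v \<times> 'v) set \<Rightarrow> nat \<Rightarrow> ('v \<Rightarrow> 'v option) \<Rightarrow> ('v \<Rightarrow> 'v option) \<Rightarrow> bool" where
  "reachable R i f g \<longleftrightarrow> assignment g \<and> card (pairs_of g - pairs_of f) \<le> i \<and>
     (pairs_of g - pairs_of f) \<inter> R = {} \<and>
     open_leaves g \<subseteq> open_leaves f \<and> open_centres g \<subseteq> open_centres f"

lemma reachable_refl: "assignment f \<Longrightarrow> reachable R i f f"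
  by (simp add: reachable_def)

lemma reachable_trans:
  assumes "reachable R i f g" "reachable R j g h"
  shows "reachable R (i + j) f h"
proof -
  let ?U = "(pairs_of h - pairs_of g) \<union> (pairs_of g - pairs_of f)"
  have "finite ?U"
    using assms finite_pairs_of by (auto simp: reachable_def)
  then have "card (pairs_of h - pairs_of f) \<le> card ?U"
    by (intro card_mono) auto
  also have "\<dots> \<le> card (pairs_of h - pairs_of g) + card (pairs_of g - pairs_of f)"
    by (rule card_Un_le)
  also have "\<dots> \<le> i + j"
    using assms by (simp add: reachable_def)
  finally show ?thesis
    using assms unfolding reachable_def by blast
qed

lemma reachable_mono: "reachable R i f g \<Longrightarrow> i \<le> j \<Longrightarrow> reachable R j f g"
  by (auto simp: reachable_def)

section \<open>Moves of Maker within a round\<close>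

lemma reachable_assign:
  assumes "assignment f" "w \<in> open_leaves f" "c \<in> open_centres f" "(c, w) \<notin> R"
  defines "g \<equiv> f(w \<mapsto> c)"
  shows "reachable R 1 f g" "open_leaves g = open_leaves f - {w}"
    "open_centres g = (if Suc (card (fibre f c)) = d then open_centres f - {c} else open_centres f)"
proof -
  have w: "f w = None" "w \<in> L0"
    using assms(2) by (auto simp: open_leaves_def)
  have c: "c \<in> C0" "card (fibre f c) < d"
    using assms(3) by (auto simp: open_centres_def)
  have fib: "card (fibre g x) = (if x = c then Suc (card (fibre f x)) else card (fibre f x))" for x
    using finite_fibre[OF assms(1)] w unfolding g_def
    by (subst fibre_upd) (simp_all add: fibre_def)
  have "ran g \<subseteq> insert c (ran f)" "dom g = insert w (dom f)"
    by (auto simp: g_def ran_def)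
  then have ass: "assignment g"
    using assms(1) w c unfolding assignment_def by (auto simp: fib)
  have new: "pairs_of g - pairs_of f \<subseteq> {(c, w)}"
    by (auto simp: pairs_of_def g_def split: if_splits)
  show leaves: "open_leaves g = open_leaves f - {w}"
    by (auto simp: open_leaves_def g_def)
  show centres: "open_centres g =
      (if Suc (card (fibre f c)) = d then open_centres f - {c} else open_centres f)"
    using c by (auto simp: open_centres_def fib)
  have "card (pairs_of g - pairs_of f) \<le> 1"
    using card_mono[OF _ new] by simp
  then show "reachable R 1 f g"
    using ass new leaves centres assms(4) by (auto simp: reachable_def)
qed

text \<open>When \<open>w\<close> and \<open>c\<close> cannot be joined, \<open>w\<close> is sent to a full centre \<open>c'\<close>,
  which releases a leaf to \<open>c\<close>.\<close>

lemma exists_full_centre: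
  assumes "assignment f" "finite R" "w \<in> open_leaves f" "c \<in> open_centres f"
    and "degree R w + degree R c + card (open_centres f) < card C0"
  obtains c' where "c' \<in> C0 - open_centres f" "(c', w) \<notin> R" "card (fibre f c') = d"
    "\<And>l. l \<in> fibre f c' \<Longrightarrow> (c, l) \<notin> R"
proof -
  let ?Rw = "{p \<in> R. fst p = w \<or> snd p = w}" and ?Rc = "{p \<in> R. fst p = c \<or> snd p = c}"
  \<comment> \<open>The unsuitable centres: those joined to \<open>w\<close>, those owning a leaf
    joined to \<open>c\<close>, and the open ones. For an unassigned leaf \<open>the\<close> yields
    an arbitrary value, which can only enlarge the set.\<close>
  let ?B = "fst ` ?Rw \<union> (\<lambda>p. the (f (snd p))) ` ?Rc \<union> open_centres f"
  have fin: "finite ?Rw" "finite ?Rc"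
    using assms(2) by auto
  have "card ?B \<le> card (fst ` ?Rw) + card ((\<lambda>p. the (f (snd p))) ` ?Rc) + card (open_centres f)"
    by (intro order_trans[OF card_Un_le] add_mono card_Un_le order_refl)
  also have "\<dots> \<le> degree R w + degree R c + card (open_centres f)"
    unfolding degree_def using fin by (intro add_mono card_image_le) auto
  finally have "card ?B < card C0"
    using assms(5) by simp
  then have "\<not> C0 \<subseteq> ?B"
    using card_mono[of ?B C0] fin by auto
  then obtain c' where c': "c' \<in> C0" "c' \<notin> ?B"
    by blast
  have "(c', w) \<notin> R"
    using c'(2) by force
  moreover have "(c, l) \<notin> R" if "l \<in> fibre f c'" for l
    using c'(2) that by (force simp: fibre_def)
  moreover have "card (fibre f c') = d"
  proof (rule antisym)
    show "card (fibre f c') \<le> d"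
      using assms(1) by (simp add: assignment_def)
    show "d \<le> card (fibre f c')"
      using c' unfolding open_centres_def by simp
  qed
  ultimately show thesis
    using c' by (intro that) auto
qed

text \<open>\<open>c'\<close> trades \<open>l\<close> for \<open>w\<close>, so its fibre keeps its
  size and only the fibre of \<open>c\<close> grows.\<close>

lemma swap_assignment:
  assumes "assignment f" "w \<in> open_leaves f" "c \<in> open_centres f"
    and "c' \<in> C0 - open_centres f" "l \<in> fibre f c'"
  defines "g \<equiv> f(w \<mapsto> c', l \<mapsto> c)"
  shows "assignment g" "pairs_of g \<subseteq> pairs_of f \<union> {(c', w), (c, l)}"
    "open_leaves g = open_leaves f - {w}" "open_centres g \<subseteq> open_centres f"
proof -
  have w: "f w = None" "w \<in> L0"
    using assms(2) by (auto simp: open_leaves_def)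
  have c: "c \<in> C0" "card (fibre f c) < d" "c \<noteq> c'"
    using assms(3,4) by (auto simp: open_centres_def)
  have l: "f l = Some c'" "l \<noteq> w" "l \<in> L0"
    using assms(1,5) w by (auto simp: fibre_def assignment_def)
  have "fibre g c = insert l (fibre f c)" "l \<notin> fibre f c"
    using w c l by (auto simp: g_def fibre_def split: if_splits)
  then have fib_c: "card (fibre g c) = Suc (card (fibre f c))"
    using finite_fibre[OF assms(1)] by simp
  have "fibre g c' = insert w (fibre f c' - {l})" "w \<notin> fibre f c'"
    using w c l by (auto simp: g_def fibre_def split: if_splits)
  then have fib_c': "card (fibre g c') = card (fibre f c')"
    using finite_fibre[OF assms(1)] card_Suc_Diff1[OF _ assms(5)] by simp
  have "fibre g x = fibre f x" if "x \<noteq> c" "x \<noteq> c'" for x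
    using w l that by (auto simp: g_def fibre_def split: if_splits)
  then have fib: "card (fibre g x) = (if x = c then Suc (card (fibre f x)) else card (fibre f x))" for x
    using fib_c fib_c' by (cases "x = c'") auto
  have "ran g \<subseteq> {c, c'} \<union> ran f" "dom g = insert w (dom f)"
    using l by (auto simp: g_def ran_def split: if_splits)
  then show "assignment g"
    using assms(1,4) w c unfolding assignment_def by (auto simp: fib)
  show "pairs_of g \<subseteq> pairs_of f \<union> {(c', w), (c, l)}"
    by (auto simp: pairs_of_def g_def split: if_splits)
  show "open_leaves g = open_leaves f - {w}"
    using l by (auto simp: open_leaves_def g_def)
  show "open_centres g \<subseteq> open_centres f"
    using c by (auto simp: open_centres_def fib split: if_splits)
qed

lemma reachable_swap:
  assumes "assignment f" "finite R" "w \<in> open_leaves f" "c \<in> open_centres f"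
    and "degree R w + degree R c + card (open_centres f) < card C0"
  shows "\<exists>g. reachable R 2 f g \<and> open_leaves g = open_leaves f - {w}"
proof -
  obtain c' where c': "c' \<in> C0 - open_centres f" "(c', w) \<notin> R" "card (fibre f c') = d"
    "\<And>l. l \<in> fibre f c' \<Longrightarrow> (c, l) \<notin> R"
    using exists_full_centre[OF assms] by blast
  obtain l where l: "l \<in> fibre f c'"
    using c'(3) d_ge_2 by fastforce
  let ?g = "f(w \<mapsto> c', l \<mapsto> c)"
  note swap = swap_assignment[OF assms(1,3,4) c'(1) l]
  have "card (pairs_of ?g - pairs_of f) \<le> card {(c', w), (c, l)}"
    using swap(2) by (intro card_mono) auto
  also have "\<dots> \<le> 2"
    by (simp add: card_insert_if)
  finally have "reachable R 2 f ?g"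
    using swap c'(2) c'(4)[OF l] by (auto simp: reachable_def)
  then show ?thesis
    using swap(3) by blast
qed

text \<open>The degree bound concerns open vertices only and \<open>R\<close> is fixed, so it
  survives each swap.\<close>

lemma reachable_swaps:
  assumes "assignment f" "finite R" "card (open_leaves f) = i"
    and "\<And>v. v \<in> open_leaves f \<union> open_centres f \<Longrightarrow> degree R v \<le> D"
    and "2 * D + card (open_centres f) < card C0"
  shows "\<exists>g. reachable R (2 * i) f g \<and> open_leaves g = {}"
  using assms
proof (induction i arbitrary: f)
  case 0
  then show ?case
    by (auto intro: reachable_refl)
next
  case (Suc i)
  obtain w where w: "w \<in> open_leaves f"
    using Suc.prems(3) by fastforce
  have "open_centres f \<noteq> {}"
    using sum_capacities[OF Suc.prems(1)] Suc.prems(3) by auto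
  then obtain c where c: "c \<in> open_centres f"
    by auto
  have "degree R w \<le> D" "degree R c \<le> D"
    using Suc.prems(4) w c by auto
  then obtain g where g: "reachable R 2 f g" "open_leaves g = open_leaves f - {w}"
    using reachable_swap[OF Suc.prems(1,2) w c] Suc.prems(5) by auto
  have sub: "open_leaves g \<union> open_centres g \<subseteq> open_leaves f \<union> open_centres f"
    using g(1) by (auto simp: reachable_def)
  have "card (open_centres g) \<le> card (open_centres f)"
    using g(1) by (intro card_mono) (auto simp: reachable_def)
  then have "2 * D + card (open_centres g) < card C0"
    using Suc.prems(5) by linarith
  moreover have "card (open_leaves g) = i"
    using g(2) w Suc.prems(3) by simp
  moreover have "assignment g"
    using g(1) by (simp add: reachable_def)
  moreover have "degree R v \<le> D" if "v \<in> open_leaves g \<union> open_centres g" for v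
    using Suc.prems(4) sub that by blast
  ultimately obtain h where h: "reachable R (2 * i) g h" "open_leaves h = {}"
    using Suc.IH[of g] Suc.prems(2) by blast
  then show ?case
    using reachable_trans[OF g(1) h(1)] by (intro exI[of _ h]) simp
qed

text \<open>Every open centre lacks exactly one leaf, so each new pair closes both of its ends and
  \<open>matching_step\<close> applies again to what remains.\<close>

lemma reachable_matching:
  assumes "assignment f" "finite R" "card (open_leaves f) = Suc i"
    and "card (open_centres f) = Suc i"
    and "edges_between R (open_centres f) (open_leaves f) < 2 * Suc i"
  shows "\<exists>g. reachable R i f g \<and> card (open_leaves g) = 1"
  using assms
proof (induction i arbitrary: f)
  case 0
  then show ?case
    by (auto intro: reachable_refl)
next
  case (Suc i)
  obtain c w where cw: "c \<in> open_centres f" "w \<in> open_leaves f" "(c, w) \<notin> R"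
    "edges_between R (open_centres f - {c}) (open_leaves f - {w}) < 2 * Suc i"
    using matching_step[of R "open_centres f" "open_leaves f"] Suc.prems by auto
  let ?g = "f(w \<mapsto> c)"
  note g = reachable_assign[OF Suc.prems(1) cw(2,1,3)]
  have "open_centres ?g = open_centres f - {c}"
    using g(3) capacity_one[OF Suc.prems(1) _ cw(1)] Suc.prems by simp
  then have "card (open_centres ?g) = Suc i" "card (open_leaves ?g) = Suc i"
    "edges_between R (open_centres ?g) (open_leaves ?g) < 2 * Suc i"
    using g(2) cw Suc.prems by simp_all
  moreover have "assignment ?g"
    using g(1) by (simp add: reachable_def)
  ultimately obtain h where h: "reachable R i ?g h" "card (open_leaves h) = 1"
    using Suc.IH[of ?g] Suc.prems(2) by blast
  then show ?case
    using reachable_trans[OF g(1) h(1)] by auto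
qed

text \<open>Each pair uses a leaf touched by Breaker, if there is one, and a centre lacking at least
  two leaves, so that no centre is closed. The lower bound on \<open>card (open_leaves f)\<close>
  guarantees more than \<open>a\<close> such centres, and Breaker blocks at most \<open>a\<close> of
  them.\<close>

lemma reachable_opening:
  assumes "assignment f" "finite R" "open_centres f = C0"
    and "card C0 + i + a * (d - 1) \<le> card (open_leaves f)"
    and "edges_between R C0 (open_leaves f) \<le> a"
  shows "\<exists>g. reachable R i f g \<and> open_centres g = C0 \<and> card (open_leaves g) + i = card (open_leaves f) \<and>
    edges_between R C0 (open_leaves g) \<le> edges_between R C0 (open_leaves f) - i"
  using assms(4)
proof (induction i)
  case 0
  then show ?case
    using assms(1,3) by (auto intro: reachable_refl)
next
  case (Suc i)
  then obtain g where g: "reachable R i f g" "open_centres g = C0"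
    "card (open_leaves g) + i = card (open_leaves f)"
    "edges_between R C0 (open_leaves g) \<le> edges_between R C0 (open_leaves f) - i"
    by auto
  have ass: "assignment g"
    using g(1) by (simp add: reachable_def)
  obtain w where w: "w \<in> open_leaves g"
    "edges_between R C0 (open_leaves g - {w}) \<le> edges_between R C0 (open_leaves g) - 1"
  proof (cases "R \<inter> C0 \<times> open_leaves g = {}")
    case True
    have "card (open_leaves g) \<noteq> 0"
      using g(3) Suc.prems by linarith
    then obtain w where "w \<in> open_leaves g"
      by fastforce
    moreover have "edges_between R C0 (open_leaves g - {w}) \<le> edges_between R C0 (open_leaves g)"
      using assms(2) by (intro edges_between_mono) auto
    ultimately show thesis
      using True that by (auto simp: edges_between_def)
  next
    case False
    then obtain x w where xw: "(x, w) \<in> R" "x \<in> C0" "w \<in> open_leaves g"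
      by auto
    have "R \<inter> C0 \<times> (open_leaves g - {w}) \<subseteq> R \<inter> C0 \<times> open_leaves g - {(x, w)}"
      by auto
    then have "card (R \<inter> C0 \<times> (open_leaves g - {w})) \<le> card (R \<inter> C0 \<times> open_leaves g - {(x, w)})"
      using assms(2) by (intro card_mono) auto
    also have "\<dots> = card (R \<inter> C0 \<times> open_leaves g) - 1"
      using xw by (intro card_Diff_singleton) auto
    finally show thesis
      using that[OF xw(3)] by (simp add: edges_between_def)
  qed
  \<comment> \<open>More than \<open>a * (d - 1)\<close> leaves exceed one per centre; they must fit
    into the roomy centres, at most \<open>d - 1\<close> into each.\<close>
  have "a * (d - 1) < (d - 1) * card (roomy_centres g)"
    using card_open_leaves_le[OF ass] g(3) Suc.prems unfolding g(2) by linarith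
  then have "a < card (roomy_centres g)"
    by (simp add: mult.commute)
  moreover have "edges_between R (roomy_centres g) (open_leaves g) \<le> edges_between R C0 (open_leaves g)"
    using assms(2) by (intro edges_between_mono) (auto simp: roomy_centres_def)
  ultimately have "edges_between R (roomy_centres g) (open_leaves g) < card (roomy_centres g)"
    using g(4) assms(5) by linarith
  then obtain c where c: "c \<in> roomy_centres g" "(c, w) \<notin> R"
    using nonadjacent_left[OF assms(2) w(1)] by blast
  let ?h = "g(w \<mapsto> c)"
  have c': "c \<in> open_centres g" "Suc (card (fibre g c)) \<noteq> d"
    using c(1) roomy_subset by (auto simp: roomy_centres_def)
  note h = reachable_assign[OF ass w(1) c'(1) c(2)]
  have "reachable R (Suc i) f ?h"
    using reachable_trans[OF g(1) h(1)] by simp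
  moreover have "open_centres ?h = C0"
    using h(3) c'(2) g(2) by simp
  moreover have "card (open_leaves ?h) + Suc i = card (open_leaves f)"
    using h(2) g(3) card_Suc_Diff1[OF finite_open_leaves w(1)] by simp
  moreover have "edges_between R C0 (open_leaves ?h) \<le> edges_between R C0 (open_leaves f) - Suc i"
    using w(2) g(4) h(2) by simp
  ultimately show ?case
    by blast
qed

section \<open>The potential\<close>

definition potential :: "('v \<times> 'v) set \<Rightarrow> 'v set \<Rightarrow> ('v \<Rightarrow> 'v option) \<Rightarrow> nat" where
  "potential R Z f = edges_between R (open_centres f) (open_leaves f)
     + 2 * card (Z \<inter> (open_centres f \<union> open_leaves f))
     + 2 * (card (open_leaves f) - card (open_centres f))"

text \<open>If open leaves outnumber open centres, some centre lacks at least two leaves; giving it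
  a non-adjacent leaf keeps it open and lowers the excess, which has weight 2. Otherwise the new
  pair closes both ends and \<open>double_step\<close> applies.\<close>

lemma potential_step:
  assumes "assignment f" "finite R" "edges_between R (open_centres f) (open_leaves f) < card (open_leaves f)"
  shows "\<exists>g. reachable R 1 f g \<and> card (open_leaves g) + 1 = card (open_leaves f) \<and>
    potential R Z g \<le> potential R Z f - 2"
proof (cases "card (open_centres f) = card (open_leaves f)")
  case True
  have "open_centres f \<inter> open_leaves f = {}"
    using open_leaves_subset open_centres_subset disjoint by blast
  then obtain c w where cw: "c \<in> open_centres f" "w \<in> open_leaves f" "(c, w) \<notin> R"
    "edges_between R (open_centres f - {c}) (open_leaves f - {w})
      + 2 * card (Z \<inter> ((open_centres f - {c}) \<union> (open_leaves f - {w})))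
      \<le> edges_between R (open_centres f) (open_leaves f) + 2 * card (Z \<inter> (open_centres f \<union> open_leaves f)) - 2"
    using double_step[of R "open_centres f" "open_leaves f" Z] assms True by auto
  note g = reachable_assign[OF assms(1) cw(2,1,3)]
  have "open_centres (f(w \<mapsto> c)) = open_centres f - {c}"
    using g(3) capacity_one[OF assms(1) True cw(1)] by simp
  then have "potential R Z (f(w \<mapsto> c)) \<le> potential R Z f - 2"
    using g(2) cw True by (simp add: potential_def)
  moreover have "card (open_leaves (f(w \<mapsto> c))) + 1 = card (open_leaves f)"
    using g(2) card_Suc_Diff1[OF finite_open_leaves cw(2)] by simp
  ultimately show ?thesis
    using g(1) by blast
next
  case False
  then have less: "card (open_centres f) < card (open_leaves f)"
    using card_open_centres_le[OF assms(1)] by simp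
  have "roomy_centres f \<noteq> {}"
    using card_open_leaves_le[OF assms(1)] less by auto
  then obtain c where c: "c \<in> open_centres f" "Suc (card (fibre f c)) \<noteq> d"
    using roomy_subset by (fastforce simp: roomy_centres_def)
  obtain w where w: "w \<in> open_leaves f" "(c, w) \<notin> R"
    using nonadjacent_right[OF assms(2) c(1) assms(3)] by blast
  note g = reachable_assign[OF assms(1) w(1) c(1) w(2)]
  let ?g = "f(w \<mapsto> c)"
  have "edges_between R (open_centres ?g) (open_leaves ?g) \<le> edges_between R (open_centres f) (open_leaves f)"
    using g(2,3) c assms(2) by (intro edges_between_mono) auto
  moreover have "card (Z \<inter> (open_centres ?g \<union> open_leaves ?g)) \<le> card (Z \<inter> (open_centres f \<union> open_leaves f))"
    using g(2,3) c by (intro card_mono) auto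
  moreover have "card (open_leaves ?g) + 1 = card (open_leaves f)"
    using g(2) card_Suc_Diff1[OF finite_open_leaves w(1)] by simp
  moreover have "open_centres ?g = open_centres f"
    using g(3) c by simp
  ultimately have "potential R Z ?g \<le> potential R Z f - 2"
    using less by (simp add: potential_def)
  then show ?thesis
    using g(1) \<open>card (open_leaves ?g) + 1 = card (open_leaves f)\<close> by blast
qed

text \<open>The potential falls by two, or to zero, whenever the number of open leaves falls by one.
  It thus stays below that number, which remains positive as \<open>i \<le> a\<close>; this is what
  \<open>potential_step\<close> needs.\<close>

lemma reachable_potential:
  assumes "assignment f" "finite R" "i \<le> a" "a < card (open_leaves f)"
    and "potential R Z f < card (open_leaves f)"
  shows "\<exists>g. reachable R i f g \<and> card (open_leaves g) + i = card (open_leaves f) \<and>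
    potential R Z g \<le> potential R Z f - 2 * i"
  using assms(3)
proof (induction i)
  case 0
  then show ?case
    using assms(1) by (auto intro: reachable_refl)
next
  case (Suc i)
  then obtain g where g: "reachable R i f g" "card (open_leaves g) + i = card (open_leaves f)"
    "potential R Z g \<le> potential R Z f - 2 * i"
    by auto
  have "edges_between R (open_centres g) (open_leaves g) < card (open_leaves g)"
    using g(2,3) assms(4,5) Suc.prems unfolding potential_def[of R Z g] by linarith
  moreover have "assignment g"
    using g(1) by (simp add: reachable_def)
  ultimately obtain h where h: "reachable R 1 g h" "card (open_leaves h) + 1 = card (open_leaves g)"
    "potential R Z h \<le> potential R Z g - 2"
    using potential_step assms(2) by blast
  then show ?case
    using reachable_trans[OF g(1) h(1)] g by (intro exI[of _ h]) auto
qed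

section \<open>The game on pairs of a centre and a leaf\<close>

text \<open>\<open>R\<close> and \<open>M\<close> are the pairs of Breaker and Maker, with Breaker
  to move. Both may claim fewer than \<open>a\<close> pairs, since real moves may also use other
  edges.\<close>

primrec pair_win :: "nat \<Rightarrow> ('v \<times> 'v) set \<Rightarrow> ('v \<times> 'v) set \<Rightarrow> bool" where
  "pair_win 0 R M \<longleftrightarrow> (\<exists>f. assignment f \<and> open_leaves f = {} \<and> pairs_of f \<subseteq> M)"
| "pair_win (Suc t) R M \<longleftrightarrow>
     (\<forall>T. T \<subseteq> C0 \<times> L0 \<and> card T \<le> a \<and> T \<inter> M = {} \<longrightarrow>
        (\<exists>S. S \<subseteq> C0 \<times> L0 \<and> card S \<le> a \<and> S \<inter> (R \<union> T) = {} \<and> pair_win t (R \<union> T) (M \<union> S)))"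

lemma finite_board: "R \<subseteq> C0 \<times> L0 \<Longrightarrow> finite R"
  using finite_C0 finite_L0 by (meson finite_SigmaI finite_subset)

lemma pairs_of_subset: "assignment f \<Longrightarrow> pairs_of f \<subseteq> C0 \<times> L0"
  by (auto simp: assignment_def pairs_of_def intro: ranI)

text \<open>The position is tracked by an assignment whose pairs Maker owns; she claims exactly the
  new pairs of \<open>g\<close>. The quantifier over \<open>M'\<close> admits the pairs that she
  owns but has abandoned.\<close>

lemma pair_win_round:
  assumes "pairs_of f \<subseteq> M"
    and "\<And>T. T \<subseteq> C0 \<times> L0 \<Longrightarrow> card T \<le> a \<Longrightarrow>
      \<exists>g. reachable (R \<union> T) a f g \<and> (\<forall>M'. pairs_of g \<subseteq> M' \<longrightarrow> pair_win t (R \<union> T) M')"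
  shows "pair_win (Suc t) R M"
  unfolding pair_win.simps
proof (intro allI impI)
  fix T
  assume "T \<subseteq> C0 \<times> L0 \<and> card T \<le> a \<and> T \<inter> M = {}"
  then obtain g where g: "reachable (R \<union> T) a f g"
    "\<And>M'. pairs_of g \<subseteq> M' \<Longrightarrow> pair_win t (R \<union> T) M'"
    using assms(2)[of T] by blast
  have "pairs_of g \<subseteq> C0 \<times> L0"
    using g(1) pairs_of_subset by (simp add: reachable_def)
  moreover have "pair_win t (R \<union> T) (M \<union> (pairs_of g - pairs_of f))"
    using assms(1) by (intro g(2)) auto
  ultimately show "\<exists>S. S \<subseteq> C0 \<times> L0 \<and> card S \<le> a \<and> S \<inter> (R \<union> T) = {} \<and> pair_win t (R \<union> T) (M \<union> S)"
    using g(1) by (intro exI[of _ "pairs_of g - pairs_of f"]) (auto simp: reachable_def)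
qed

section \<open>Finishing in one or two rounds\<close>

lemma pair_win_swaps:
  assumes "assignment f" "R \<subseteq> C0 \<times> L0" "2 * card (open_leaves f) \<le> a"
    and "\<And>v. v \<in> open_leaves f \<union> open_centres f \<Longrightarrow> degree R v \<le> D"
    and "2 * (D + a) + card (open_centres f) < card C0" "pairs_of f \<subseteq> M"
  shows "pair_win (Suc 0) R M"
proof (rule pair_win_round[OF assms(6)])
  fix T
  assume T: "T \<subseteq> C0 \<times> L0" "card T \<le> a"
  have fin: "finite (R \<union> T)"
    using finite_board assms(2) T by auto
  have "degree (R \<union> T) v \<le> D + a" if "v \<in> open_leaves f \<union> open_centres f" for v
    using degree_Un[of T R v] fin assms(4)[OF that] T(2) by simp
  then obtain g where g: "reachable (R \<union> T) (2 * card (open_leaves f)) f g" "open_leaves g = {}"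
    using reachable_swaps[OF assms(1) fin refl _ assms(5)] by blast
  show "\<exists>g. reachable (R \<union> T) a f g \<and> (\<forall>M'. pairs_of g \<subseteq> M' \<longrightarrow> pair_win 0 (R \<union> T) M')"
    using reachable_mono[OF g(1) assms(3)] g(2) by (auto simp: reachable_def)
qed

text \<open>For \<open>a = 1\<close> the swap is spread over two rounds. The full centre joined to \<open>w\<close> in
  the first one can release either of two leaves, and Breaker blocks only one of them.\<close>

lemma pair_win_slow_swap:
  assumes "a = 1" "assignment f" "R \<subseteq> C0 \<times> L0" "open_leaves f = {w}" "c \<in> open_centres f"
    and "\<And>v. v \<in> open_leaves f \<union> open_centres f \<Longrightarrow> degree R v \<le> D"
    and "2 * (D + 1) + card (open_centres f) < card C0" "pairs_of f \<subseteq> M"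
  shows "pair_win (Suc (Suc 0)) R M"
  unfolding pair_win.simps(2)[of "Suc 0"]
proof (intro allI impI)
  fix T
  assume T: "T \<subseteq> C0 \<times> L0 \<and> card T \<le> a \<and> T \<inter> M = {}"
  let ?R = "R \<union> T"
  have fin: "finite ?R"
    using finite_board assms(3) T by auto
  have w: "w \<in> open_leaves f"
    using assms(4) by simp
  have "degree ?R v \<le> D + 1" if "v \<in> open_leaves f \<union> open_centres f" for v
    using degree_Un[of T R v] fin assms(1) assms(6)[OF that] T by simp
  then have "degree ?R w \<le> D + 1" "degree ?R c \<le> D + 1"
    using w assms(5) by auto
  then have "degree ?R w + degree ?R c + card (open_centres f) < card C0"
    using assms(7) by simp
  then obtain c' where c': "c' \<in> C0 - open_centres f" "(c', w) \<notin> ?R" "card (fibre f c') = d"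
    "\<And>l. l \<in> fibre f c' \<Longrightarrow> (c, l) \<notin> ?R"
    using exists_full_centre[OF assms(2) fin w assms(5)] by blast
  have cw: "(c', w) \<in> C0 \<times> L0"
    using c'(1) w open_leaves_subset by auto
  have "pair_win (Suc 0) ?R (M \<union> {(c', w)})"
    unfolding pair_win.simps(2)[of 0]
  proof (intro allI impI)
    fix T'
    assume T': "T' \<subseteq> C0 \<times> L0 \<and> card T' \<le> a \<and> T' \<inter> (M \<union> {(c', w)}) = {}"
    have "\<exists>l\<in>fibre f c'. (c, l) \<notin> T'"
    proof (rule ccontr)
      assume "\<not> ?thesis"
      then have "Pair c ` fibre f c' \<subseteq> T'"
        by auto
      then have "card (Pair c ` fibre f c') \<le> card T'"
        using T' finite_board by (intro card_mono) auto
      moreover have "card (Pair c ` fibre f c') = d"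
        using c'(3) by (simp add: card_image inj_on_def)
      ultimately show False
        using T' assms(1) d_ge_2 by simp
    qed
    then obtain l where l: "l \<in> fibre f c'" "(c, l) \<notin> T'"
      by blast
    note swap = swap_assignment[OF assms(2) w assms(5) c'(1) l(1)]
    have "(c, l) \<in> C0 \<times> L0"
      using assms(2,5) l(1) open_centres_subset by (auto simp: assignment_def fibre_def)
    moreover have "pair_win 0 (?R \<union> T') (M \<union> {(c', w)} \<union> {(c, l)})"
      unfolding pair_win.simps using swap assms(4,8) by blast
    ultimately show "\<exists>S. S \<subseteq> C0 \<times> L0 \<and> card S \<le> a \<and> S \<inter> (?R \<union> T') = {} \<and>
        pair_win 0 (?R \<union> T') (M \<union> {(c', w)} \<union> S)"
      using l c'(4)[OF l(1)] a_pos by (intro exI[of _ "{(c, l)}"]) auto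
  qed
  then show "\<exists>S. S \<subseteq> C0 \<times> L0 \<and> card S \<le> a \<and> S \<inter> ?R = {} \<and> pair_win (Suc 0) ?R (M \<union> S)"
    using cw c'(2) a_pos by (intro exI[of _ "{(c', w)}"]) auto
qed

text \<open>For \<open>1 \<le> r\<close> and \<open>r \<le> a\<close> the sum
  \<open>j + last_rounds r\<close> equals \<open>(r + a * j) div a + 1\<close>, the number of moves
  that Maker is allowed for \<open>r + a * j\<close> leaves.\<close>

definition last_rounds :: "nat \<Rightarrow> nat" where
  "last_rounds r = (if r < a then 1 else 2)"

lemma pair_win_final:
  assumes "assignment f" "R \<subseteq> C0 \<times> L0"
    and "card (open_leaves f) = r" "card (open_centres f) = r" "1 \<le> r" "r \<le> a"
    and "edges_between R (open_centres f) (open_leaves f) = 0"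
    and deg: "\<And>v. v \<in> open_leaves f \<union> open_centres f \<Longrightarrow> degree R v \<le> D"
    and D: "2 * (D + 2 * a) + a < card C0" and "pairs_of f \<subseteq> M"
  shows "pair_win (last_rounds r) R M"
proof -
  obtain i where r: "r = Suc i"
    using assms(5) by (cases r) auto
  \<comment> \<open>Fewer than \<open>2 * r\<close> pairs of Breaker cannot prevent
    \<open>i = r - 1\<close> direct pairs. The term \<open>D + a + a\<close> leaves room for one
    more move of Breaker.\<close>
  have match: "\<exists>g. reachable (R \<union> T) i f g \<and> card (open_leaves g) = 1 \<and>
      (\<forall>v\<in>open_leaves g \<union> open_centres g. degree (R \<union> T) v \<le> D + a) \<and>
      2 * (D + a + a) + card (open_centres g) < card C0"
    if T: "T \<subseteq> C0 \<times> L0" "card T \<le> a" and "a < 2 * r" for T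
  proof -
    have fin: "finite (R \<union> T)"
      using finite_board assms(2) T(1) by auto
    have "edges_between (R \<union> T) (open_centres f) (open_leaves f) < 2 * Suc i"
      using edges_between_Un[OF finite_board[OF T(1)], of R "open_centres f" "open_leaves f"]
        assms(7) T(2) that(3) unfolding r by simp
    then obtain g where g: "reachable (R \<union> T) i f g" "card (open_leaves g) = 1"
      using reachable_matching[OF assms(1) fin, of i] assms(3,4) unfolding r by blast
    have "degree (R \<union> T) v \<le> D + a" if "v \<in> open_leaves g \<union> open_centres g" for v
    proof -
      have "v \<in> open_leaves f \<union> open_centres f"
        using that g(1) by (auto simp: reachable_def)
      then show ?thesis
        using degree_Un[OF finite_board[OF T(1)], of R v] T(2) deg[of v] by simp
    qed
    moreover have "card (open_centres g) \<le> card (open_centres f)"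
      using g(1) by (intro card_mono) (auto simp: reachable_def)
    ultimately show ?thesis
      using g D assms(4,6) by (intro exI[of _ g]) auto
  qed
  consider "r < a" "2 * r \<le> a" | "r < a" "a < 2 * r" | "r = a" "2 \<le> a" | "r = a" "a = 1"
    using assms(5,6) by linarith
  then show ?thesis
  proof cases
    \<comment> \<open>Two pairs for each leaf fit into one move.\<close>
    case 1
    then show ?thesis
      using pair_win_swaps[OF assms(1,2) _ deg, of M] assms(3,4,10) D by (simp add: last_rounds_def)
  next
    \<comment> \<open>\<open>r - 1\<close> direct pairs and one swap need
      \<open>r + 1 \<le> a\<close> pairs.\<close>
    case 2
    have "pair_win (Suc 0) R M"
    proof (rule pair_win_round[OF assms(10)])
      fix T
      assume T: "T \<subseteq> C0 \<times> L0" "card T \<le> a"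
      obtain g where g: "reachable (R \<union> T) i f g" "card (open_leaves g) = 1"
        "\<And>v. v \<in> open_leaves g \<union> open_centres g \<Longrightarrow> degree (R \<union> T) v \<le> D + a"
        "2 * (D + a + a) + card (open_centres g) < card C0"
        using match[OF T 2(2)] by blast
      have "assignment g" "finite (R \<union> T)"
        using g(1) finite_board assms(2) T by (auto simp: reachable_def)
      then obtain h where h: "reachable (R \<union> T) (2 * 1) g h" "open_leaves h = {}"
        using reachable_swaps[of g "R \<union> T" 1 "D + a"] g by auto
      have "reachable (R \<union> T) a f h"
        using reachable_mono[OF reachable_trans[OF g(1) h(1)]] 2 r by simp
      then show "\<exists>g. reachable (R \<union> T) a f g \<and> (\<forall>M'. pairs_of g \<subseteq> M' \<longrightarrow> pair_win 0 (R \<union> T) M')"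
        using h(2) by (intro exI[of _ h]) (auto simp: reachable_def)
    qed
    then show ?thesis
      using 2 by (simp add: last_rounds_def)
  next
    \<comment> \<open>The matching takes \<open>a - 1\<close> pairs of this move; the swap for the
      last leaf fits into the next move because \<open>2 \<le> a\<close>.\<close>
    case 3
    have "pair_win (Suc (Suc 0)) R M"
    proof (rule pair_win_round[OF assms(10)])
      fix T
      assume T: "T \<subseteq> C0 \<times> L0" "card T \<le> a"
      obtain g where g: "reachable (R \<union> T) i f g" "card (open_leaves g) = 1"
        "\<And>v. v \<in> open_leaves g \<union> open_centres g \<Longrightarrow> degree (R \<union> T) v \<le> D + a"
        "2 * (D + a + a) + card (open_centres g) < card C0"
        using match[OF T] 3 by auto
      have "assignment g" "R \<union> T \<subseteq> C0 \<times> L0"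
        using g(1) assms(2) T by (auto simp: reachable_def)
      then have "pair_win (Suc 0) (R \<union> T) M'" if "pairs_of g \<subseteq> M'" for M'
        using pair_win_swaps[of g "R \<union> T" "D + a"] g(2,3,4) 3 that by auto
      moreover have "reachable (R \<union> T) a f g"
        using reachable_mono[OF g(1)] 3 r by simp
      ultimately show "\<exists>g. reachable (R \<union> T) a f g \<and>
          (\<forall>M'. pairs_of g \<subseteq> M' \<longrightarrow> pair_win (Suc 0) (R \<union> T) M')"
        by blast
    qed
    then show ?thesis
      using 3 by (simp add: last_rounds_def numeral_2_eq_2)
  next
    case 4
    obtain w c where "open_leaves f = {w}" "open_centres f = {c}"
      using assms(3,4) 4 by (metis card_1_singletonE)
    then have "pair_win (Suc (Suc 0)) R M"
      using pair_win_slow_swap[OF 4(2) assms(1,2) _ _ deg, of w c M] D 4 assms(10) by auto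
    moreover have "last_rounds r = Suc (Suc 0)"
      using 4(1) by (simp add: last_rounds_def)
    ultimately show ?thesis
      by (simp only:)
  qed
qed

section \<open>Invariants over many rounds\<close>

lemma potential_Un:
  assumes "T \<subseteq> C0 \<times> L0"
  shows "potential (R \<union> T) Z f \<le> potential R Z f + card T"
  using edges_between_Un[OF finite_board[OF assms]] by (simp add: potential_def)

text \<open>Breaker adds at most \<open>a\<close> to the potential and Maker takes off
  \<open>2 * a\<close>, so the net loss keeps pace with the \<open>a\<close> leaves used. As the
  slack \<open>Y\<close> exceeds \<open>a\<close>, the potential is still below the number of open
  leaves after Breaker's move.\<close>

lemma potential_round:
  assumes "assignment f" "R \<subseteq> C0 \<times> L0" "T \<subseteq> C0 \<times> L0" "card T \<le> a"
    and "a < card (open_leaves f)" "a < Y" "potential R Z f \<le> card (open_leaves f) - Y"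
  shows "\<exists>g. reachable (R \<union> T) a f g \<and> card (open_leaves g) + a = card (open_leaves f) \<and>
    potential (R \<union> T) Z g \<le> card (open_leaves g) - Y"
proof -
  have fin: "finite (R \<union> T)"
    using finite_board assms(2,3) by auto
  have "potential (R \<union> T) Z f \<le> card (open_leaves f) - Y + a"
    using potential_Un[OF assms(3), of R Z f] assms(4,7) by simp
  moreover from this have "potential (R \<union> T) Z f < card (open_leaves f)"
    using assms(5,6) by linarith
  ultimately obtain g where g: "reachable (R \<union> T) a f g" "card (open_leaves g) + a = card (open_leaves f)"
    "potential (R \<union> T) Z g \<le> card (open_leaves f) - Y + a - 2 * a"
    using reachable_potential[OF assms(1) fin order_refl assms(5), of Z]
    by (meson diff_le_mono le_trans)
  have "potential (R \<union> T) Z g \<le> card (open_leaves g) - Y"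
    using g(2,3) by linarith
  then show ?thesis
    using g by blast
qed

text \<open>The slack \<open>a + 1\<close> forces the potential to be 0 once only
  \<open>r \<le> a\<close> leaves are open, so no vertex of \<open>Z\<close> is open then. For the
  other open vertices a degree grows by at most \<open>a\<close> per round while the number of open
  leaves drops by \<open>a\<close>, so the sum stays bounded by \<open>D\<close>.\<close>

lemma pair_win_endgame:
  assumes "1 \<le> r" "r \<le> a" "2 * (D + 2 * a) + a < card C0"
    and "assignment f" "R \<subseteq> C0 \<times> L0" "card (open_leaves f) = r + a * j"
    and "potential R Z f \<le> card (open_leaves f) - (a + 1)"
    and "\<And>v. v \<in> open_leaves f \<union> open_centres f \<Longrightarrow> v \<notin> Z \<Longrightarrow> degree R v + card (open_leaves f) \<le> D"
    and "pairs_of f \<subseteq> M"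
  shows "pair_win (j + last_rounds r) R M"
  using assms(4-)
proof (induction j arbitrary: f R M)
  case 0
  have pot: "potential R Z f = 0"
    using 0 assms(2) by simp
  then have "Z \<inter> (open_centres f \<union> open_leaves f) = {}"
    by (simp add: potential_def)
  then have "degree R v \<le> D" if "v \<in> open_leaves f \<union> open_centres f" for v
    using 0(5)[OF that] that by (meson UnCI UnE add_leD1 disjoint_iff)
  moreover have "card (open_centres f) = r"
    using pot card_open_centres_le[OF 0(1)] 0(3) by (simp add: potential_def)
  moreover have "edges_between R (open_centres f) (open_leaves f) = 0"
    using pot by (simp add: potential_def)
  ultimately show ?case
    using pair_win_final[OF 0(1,2) _ _ assms(1,2) _ _ assms(3)] 0(3,6) by simp
next
  case (Suc j)
  have "pair_win (Suc (j + last_rounds r)) R M"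
  proof (rule pair_win_round[OF Suc.prems(6)])
    fix T
    assume T: "T \<subseteq> C0 \<times> L0" "card T \<le> a"
    have a: "a < card (open_leaves f)"
      using Suc.prems(3) assms(1) by simp
    obtain g where g: "reachable (R \<union> T) a f g" "card (open_leaves g) + a = card (open_leaves f)"
      "potential (R \<union> T) Z g \<le> card (open_leaves g) - (a + 1)"
      using potential_round[OF Suc.prems(1,2) T a _ Suc.prems(4)] by auto
    have "degree (R \<union> T) v + card (open_leaves g) \<le> D"
      if "v \<in> open_leaves g \<union> open_centres g" "v \<notin> Z" for v
    proof -
      have "v \<in> open_leaves f \<union> open_centres f"
        using that g(1) by (auto simp: reachable_def)
      then have "degree R v + card (open_leaves f) \<le> D"
        using Suc.prems(5) that(2) by blast
      then show ?thesis
        using degree_Un[OF finite_board[OF T(1)], of R v] T(2) g(2) by linarith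
    qed
    moreover have "assignment g" "R \<union> T \<subseteq> C0 \<times> L0" "card (open_leaves g) = r + a * j"
      using g(1,2) Suc.prems(2,3) T by (auto simp: reachable_def)
    ultimately have "pair_win (j + last_rounds r) (R \<union> T) M'" if "pairs_of g \<subseteq> M'" for M'
      using Suc.IH[of g "R \<union> T" M'] g(3) that by blast
    then show "\<exists>g. reachable (R \<union> T) a f g \<and>
        (\<forall>M'. pairs_of g \<subseteq> M' \<longrightarrow> pair_win (j + last_rounds r) (R \<union> T) M')"
      using g(1) by blast
  qed
  then show ?case
    by simp
qed

text \<open>Once the number of open leaves has dropped below \<open>Y\<close>, Breaker can raise a degree by at
  most about \<open>Y\<close>, so it suffices to dispose of the boundedly many vertices which have
  degree at least \<open>\<theta>\<close> at that moment.\<close>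

lemma pair_win_middle:
  assumes "1 \<le> r" "r \<le> a" "2 * (\<theta> + Y + 2 * a) + a < card C0"
    and \<theta>: "\<And>z. \<theta> * z \<le> 2 * card L0 \<Longrightarrow> 2 * z + 2 * a + 1 \<le> Y"
    and "assignment f" "R \<subseteq> C0 \<times> L0" "card (open_leaves f) = r + a * j"
    and "potential R {} f \<le> card (open_leaves f) - Y" "Y \<le> card (open_leaves f) + a"
    and "card R + card (open_leaves f) \<le> card L0" "pairs_of f \<subseteq> M"
  shows "pair_win (j + last_rounds r) R M"
  using assms(5-)
proof (induction j arbitrary: f R M)
  case 0
  have Y: "2 * a < Y"
    using \<theta>[of 0] by simp
  \<comment> \<open>Vacuous: \<open>r \<le> a\<close> open leaves contradict
    \<open>Y \<le> card (open_leaves f) + a\<close>, as \<open>2 * a < Y\<close>.\<close>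
  show ?case
    using 0(3,5) Y assms(2) by simp
next
  case (Suc j)
  have Y: "2 * a < Y"
    using \<theta>[of 0] by simp
  show ?case
  proof (cases "card (open_leaves f) \<le> Y")
    case True
    let ?Z = "{v \<in> C0 \<union> L0. \<theta> \<le> degree R v}"
    have "\<theta> * card ?Z \<le> 2 * card R"
      using finite_board Suc.prems(2) finite_C0 finite_L0 by (intro card_high_degree) auto
    \<comment> \<open>Each round uses up \<open>a\<close> leaves and gives Breaker at most
      \<open>a\<close> pairs, so he never owns more than \<open>card L0\<close>.\<close>
    also have "\<dots> \<le> 2 * card L0"
      using Suc.prems(6) by simp
    finally have Z: "2 * card ?Z + 2 * a + 1 \<le> Y"
      by (rule \<theta>)
    have "card (?Z \<inter> (open_centres f \<union> open_leaves f)) \<le> card ?Z"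
      using finite_C0 finite_L0 by (intro card_mono) auto
    then have "potential R ?Z f \<le> potential R {} f + 2 * card ?Z"
      by (simp add: potential_def)
    \<comment> \<open>Since \<open>card (open_leaves f) \<le> Y\<close>, the potential without
      \<open>?Z\<close> is 0, and \<open>2 * card ?Z \<le> Y - 2 * a - 1\<close> is small enough by
      \<open>Y \<le> card (open_leaves f) + a\<close>.\<close>
    also have "\<dots> \<le> card (open_leaves f) - (a + 1)"
      using Suc.prems(4,5) True Z by linarith
    finally have pot: "potential R ?Z f \<le> card (open_leaves f) - (a + 1)" .
    have "degree R v + card (open_leaves f) \<le> \<theta> + Y"
      if "v \<in> open_leaves f \<union> open_centres f" "v \<notin> ?Z" for v
    proof -
      have "degree R v \<le> \<theta>"
        using that open_leaves_subset open_centres_subset by fastforce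
      then show ?thesis
        using True by simp
    qed
    then show ?thesis
      using pair_win_endgame[OF assms(1-3) Suc.prems(1-3) pot _ Suc.prems(7)] by blast
  next
    case False
    have "pair_win (Suc (j + last_rounds r)) R M"
    proof (rule pair_win_round[OF Suc.prems(7)])
      fix T
      assume T: "T \<subseteq> C0 \<times> L0" "card T \<le> a"
      have a: "a < card (open_leaves f)" "a < Y"
        using Suc.prems(3) assms(1) Y by simp_all
      obtain g where g: "reachable (R \<union> T) a f g" "card (open_leaves g) + a = card (open_leaves f)"
        "potential (R \<union> T) {} g \<le> card (open_leaves g) - Y"
        using potential_round[OF Suc.prems(1,2) T a Suc.prems(4)] by auto
      have "card (R \<union> T) + card (open_leaves g) \<le> card L0"
        using card_Un_le[of R T] T(2) g(2) Suc.prems(6) by linarith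
      moreover have "assignment g" "R \<union> T \<subseteq> C0 \<times> L0" "card (open_leaves g) = r + a * j"
        using g(1,2) Suc.prems(2,3) T by (auto simp: reachable_def)
      moreover have "Y \<le> card (open_leaves g) + a"
        using False g(2) by simp
      ultimately have "pair_win (j + last_rounds r) (R \<union> T) M'" if "pairs_of g \<subseteq> M'" for M'
        using Suc.IH[of g "R \<union> T" M'] g(3) that by blast
      then show "\<exists>g. reachable (R \<union> T) a f g \<and>
          (\<forall>M'. pairs_of g \<subseteq> M' \<longrightarrow> pair_win (j + last_rounds r) (R \<union> T) M')"
        using g(1) by blast
    qed
    then show ?thesis
      by simp
  qed
qed

text \<open>While at least \<open>card C0 + a * d\<close> leaves are open, Maker ends each round
  with no Breaker pair between open vertices. After that the potential is twice the excess, which is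
  below \<open>a * d\<close>, and \<open>a * d + Y \<le> card C0\<close> yields the slack
  \<open>Y\<close>.\<close>

lemma pair_win_opening:
  assumes "1 \<le> r" "r \<le> a" "2 * (\<theta> + Y + 2 * a) + a < card C0"
    and \<theta>: "\<And>z. \<theta> * z \<le> 2 * card L0 \<Longrightarrow> 2 * z + 2 * a + 1 \<le> Y" and "a * d + Y \<le> card C0"
    and "assignment f" "R \<subseteq> C0 \<times> L0" "card (open_leaves f) = r + a * j"
    and "open_centres f = C0" "edges_between R C0 (open_leaves f) = 0"
    and "card R + card (open_leaves f) \<le> card L0" "pairs_of f \<subseteq> M"
  shows "pair_win (j + last_rounds r) R M"
  using assms(6-)
proof (induction j arbitrary: f R M)
  case 0
  \<comment> \<open>Vacuous: all of \<open>C0\<close> is open, so more than \<open>a\<close> leaves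
    are open.\<close>
  then show ?case
    using card_open_centres_le[OF 0(1)] assms(2,3) by simp
next
  case (Suc j)
  show ?case
  proof (cases "card C0 + a * d \<le> card (open_leaves f)")
    case False
    have "card C0 \<le> card (open_leaves f)"
      using card_open_centres_le[OF Suc.prems(1)] Suc.prems(4) by simp
    moreover from this have "potential R {} f \<le> card (open_leaves f) - Y"
      using Suc.prems(4,5) False assms(5) by (simp add: potential_def)
    ultimately show ?thesis
      using pair_win_middle[OF assms(1-3) \<theta> Suc.prems(1-3) _ _ Suc.prems(6,7)] assms(5) by simp
  next
    case True
    have "pair_win (Suc (j + last_rounds r)) R M"
    proof (rule pair_win_round[OF Suc.prems(7)])
      fix T
      assume T: "T \<subseteq> C0 \<times> L0" "card T \<le> a"
      have fin: "finite (R \<union> T)"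
        using finite_board Suc.prems(2) T by auto
      have "a + a * (d - 1) = a * d"
        using d_ge_2 by (cases d) auto
      then have "card C0 + a + a * (d - 1) \<le> card (open_leaves f)"
        using True by simp
      moreover have "edges_between (R \<union> T) C0 (open_leaves f) \<le> a"
        using edges_between_Un[OF finite_board[OF T(1)], of R C0 "open_leaves f"] Suc.prems(5) T(2) by simp
      ultimately obtain g where g: "reachable (R \<union> T) a f g" "open_centres g = C0"
        "card (open_leaves g) + a = card (open_leaves f)" "edges_between (R \<union> T) C0 (open_leaves g) = 0"
        using reachable_opening[OF Suc.prems(1) fin Suc.prems(4), of a] by auto
      have "card (R \<union> T) + card (open_leaves g) \<le> card L0"
        using card_Un_le[of R T] T(2) g(3) Suc.prems(6) by linarith
      moreover have "assignment g" "R \<union> T \<subseteq> C0 \<times> L0" "card (open_leaves g) = r + a * j"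
        using g(1,3) Suc.prems(2,3) T by (auto simp: reachable_def)
      ultimately have "pair_win (j + last_rounds r) (R \<union> T) M'" if "pairs_of g \<subseteq> M'" for M'
        using Suc.IH[of g "R \<union> T" M'] g(2,4) that by blast
      then show "\<exists>g. reachable (R \<union> T) a f g \<and>
          (\<forall>M'. pairs_of g \<subseteq> M' \<longrightarrow> pair_win (j + last_rounds r) (R \<union> T) M')"
        using g(1) by blast
    qed
    then show ?thesis
      by simp
  qed
qed

lemma pair_win_initial:
  assumes "1000 * (a * d) \<le> card C0"
  shows "pair_win (card L0 div a + 1) {} {}"
proof -
  \<comment> \<open>\<open>Y\<close> serves as slack and as degree threshold. A fixed fraction of
    \<open>card C0\<close> gives \<open>4 * Y + 5 * a < card C0\<close>, while at most
    \<open>32 * d\<close> vertices reach degree \<open>Y\<close> in a graph with at most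
    \<open>card L0\<close> edges; the factor 1000 makes \<open>Y\<close> exceed
    \<open>64 * d + 2 * a + 1\<close>.\<close>
  define Y where "Y = card C0 div 8"
  then have Y8: "8 * Y \<le> card C0" "card C0 \<le> 8 * Y + 7"
    by linarith+
  define p where "p = a * d"
  have ad: "a \<le> p" "d \<le> p" "1 \<le> p" "1000 * p \<le> card C0"
    using a_pos d_ge_2 assms by (auto simp: p_def)
  have Y: "125 * p \<le> Y + 1"
    using ad Y8 by linarith
  have "2 * z + 2 * a + 1 \<le> Y" if "Y * z \<le> 2 * card L0" for z
  proof -
    have "card C0 \<le> 16 * Y"
      using Y Y8 ad by linarith
    then have "2 * card L0 \<le> 2 * (d * (16 * Y))"
      using card_L0 by simp
    also have "2 * (d * (16 * Y)) = Y * (32 * d)"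
      by (simp add: ac_simps)
    finally have "Y * z \<le> Y * (32 * d)"
      using that by (rule order_trans[rotated])
    moreover have "0 < Y"
      using Y Y8 ad by linarith
    ultimately have "z \<le> 32 * d"
      by simp
    then show ?thesis
      using Y Y8 ad by linarith
  qed
  moreover have "2 * (Y + Y + 2 * a) + a < card C0"
    using Y8 ad by simp
  moreover have "a * d + Y \<le> card C0"
    unfolding p_def[symmetric] using Y8 ad by linarith
  moreover have "assignment Map.empty" "open_centres Map.empty = C0" "open_leaves Map.empty = L0"
    using d_ge_2 by (auto simp: assignment_def open_centres_def open_leaves_def fibre_def)
  moreover have "pairs_of Map.empty = {}"
    by (simp add: pairs_of_def)
  ultimately have win: "pair_win (j + last_rounds r) {} {}"
    if "1 \<le> r" "r \<le> a" "card L0 = r + a * j" for r j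
    using pair_win_opening[OF that(1,2), of Y Y Map.empty "{}" j "{}"] that(3)
    by (simp add: edges_between_def)
  show ?thesis
  \<comment> \<open>The remainder \<open>r\<close> is taken between 1 and \<open>a\<close>, so in
    the divisible case it is \<open>a\<close> and the quotient drops by one.\<close>
  proof (cases "a dvd card L0")
    case True
    then obtain j where j: "card L0 = a * j"
      by blast
    have "card C0 \<noteq> 0"
      using ad by linarith
    then have "card L0 \<noteq> 0"
      using card_L0 d_ge_2 by simp
    then have "j \<noteq> 0"
      using j by (cases j) auto
    then obtain i where "j = Suc i"
      by (cases j) auto
    then show ?thesis
      using win[of a i] j a_pos by (simp add: last_rounds_def)
  next
    case False
    have "1 \<le> card L0 mod a" "card L0 mod a < a"
      using False a_pos by (auto simp: dvd_eq_mod_eq_0 Suc_le_eq)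
    then show ?thesis
      using win[of "card L0 mod a" "card L0 div a"] by (simp add: last_rounds_def)
  qed
qed

end

section \<open>Positions and strategies\<close>

text \<open>The original game on claimed sets instead of histories, with \<open>t\<close> rounds
  left and Breaker to move.\<close>

primrec position_win :: "nat \<Rightarrow> 'e set \<Rightarrow> 'e set set \<Rightarrow> nat \<Rightarrow> 'e set \<Rightarrow> 'e set \<Rightarrow> bool" where
  "position_win a X F 0 B M \<longleftrightarrow> (\<exists>W\<in>F. W \<subseteq> M)"
| "position_win a X F (Suc t) B M \<longleftrightarrow>
     (\<forall>T. T \<subseteq> X - (B \<union> M) \<and> card T = min a (card (X - (B \<union> M))) \<longrightarrow>
        (\<exists>S. S \<subseteq> X - (B \<union> T \<union> M) \<and> card S = min a (card (X - (B \<union> T \<union> M))) \<and>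
          position_win a X F t (B \<union> T) (M \<union> S)))"

definition breaker_claimed :: "'e set list \<Rightarrow> 'e set" where
  "breaker_claimed h = (\<Union>i\<in>{i. i < length h \<and> even i}. h ! i)"

lemma maker_claimed_snoc:
  "maker_claimed (h @ [T]) = (if odd (length h) then maker_claimed h \<union> T else maker_claimed h)"
proof -
  have "{i. i < length (h @ [T]) \<and> odd i} = {i. i < length h \<and> odd i} \<union> {i. i = length h \<and> odd i}"
    by auto
  then show ?thesis
    by (auto simp: maker_claimed_def nth_append split: if_splits)
qed

lemma breaker_claimed_snoc:
  "breaker_claimed (h @ [T]) = (if even (length h) then breaker_claimed h \<union> T else breaker_claimed h)"
proof -
  have "{i. i < length (h @ [T]) \<and> even i} = {i. i < length h \<and> even i} \<union> {i. i = length h \<and> even i}"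
    by auto
  then show ?thesis
    by (auto simp: breaker_claimed_def nth_append split: if_splits)
qed

lemma free_elements_eq: "free_elements X h = X - (breaker_claimed h \<union> maker_claimed h)"
proof -
  have "\<Union> (set h) = breaker_claimed h \<union> maker_claimed h"
    unfolding breaker_claimed_def maker_claimed_def set_conv_nth by blast
  then show ?thesis
    by (simp add: free_elements_def)
qed

lemma length_play [simp]: "length (play breaker maker i) = i"
  by (induction i) (auto simp: Let_def)

lemma exists_legal_move:
  assumes "finite X"
  shows "\<exists>S. legal_move a X h S"
proof -
  have "min a (card (free_elements X h)) \<le> card (free_elements X h)"
    by simp
  then show ?thesis
    unfolding legal_move_def by (metis obtain_subset_with_card_n)
qed

text \<open>Maker picks a move after which the position is still won with one round less, if there
  is one. A strategy must be legal after every history, so elsewhere she takes any legal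
  move.\<close>

lemma mb_tau_le:
  assumes "finite X" and win: "position_win a X F t {} {}"
  shows "mb_tau a X F \<le> enat t"
proof -
  \<comment> \<open>At Maker's turn in round \<open>i\<close>, counted from 0, the history has
    length \<open>2 * i + 1\<close>, so \<open>t - Suc i\<close> rounds remain after her
    move.\<close>
  define good where "good h S \<longleftrightarrow> legal_move a X h S \<and>
    position_win a X F (t - Suc (length h div 2)) (breaker_claimed h) (maker_claimed h \<union> S)" for h S
  define maker where "maker h = (if \<exists>S. good h S then SOME S. good h S else SOME S. legal_move a X h S)" for h
  have good_maker: "good h (maker h)" if "good h S" for h S
    using that unfolding maker_def by (metis someI)
  have legal: "legal_strategy a X maker"
    unfolding legal_strategy_def
  proof
    fix h
    show "legal_move a X h (maker h)"
    proof (cases "\<exists>S. good h S")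
      case True
      then show ?thesis
        using good_maker good_def by blast
    next
      case False
      then show ?thesis
        using exists_legal_move[OF assms(1), of a h] by (simp add: maker_def someI_ex)
    qed
  qed
  have "maker_wins_within a X F maker t"
    unfolding maker_wins_within_def
  proof (intro allI impI)
    fix breaker
    assume breaker: "legal_strategy a X breaker"
    have "position_win a X F (t - i) (breaker_claimed (play breaker maker (2 * i)))
        (maker_claimed (play breaker maker (2 * i)))" if "i \<le> t" for i
      using that
    proof (induction i)
      case 0
      then show ?case
        using win by (simp add: breaker_claimed_def maker_claimed_def)
    next
      case (Suc i)
      let ?h = "play breaker maker (2 * i)"
      let ?T = "breaker ?h"
      let ?h' = "?h @ [?T]"
      have pos: "position_win a X F (Suc (t - Suc i)) (breaker_claimed ?h) (maker_claimed ?h)"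
        using Suc by (simp add: Suc_diff_Suc)
      have "legal_move a X ?h ?T"
        using breaker by (simp add: legal_strategy_def)
      then have T: "?T \<subseteq> X - (breaker_claimed ?h \<union> maker_claimed ?h) \<and>
          card ?T = min a (card (X - (breaker_claimed ?h \<union> maker_claimed ?h)))"
        by (simp only: legal_move_def free_elements_eq)
      obtain S where S: "S \<subseteq> X - (breaker_claimed ?h \<union> ?T \<union> maker_claimed ?h)"
        "card S = min a (card (X - (breaker_claimed ?h \<union> ?T \<union> maker_claimed ?h)))"
        "position_win a X F (t - Suc i) (breaker_claimed ?h \<union> ?T) (maker_claimed ?h \<union> S)"
        using pos[unfolded position_win.simps(2), rule_format, OF T] by blast
      have claimed: "breaker_claimed ?h' = breaker_claimed ?h \<union> ?T" "maker_claimed ?h' = maker_claimed ?h"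
        by (simp_all add: breaker_claimed_snoc maker_claimed_snoc)
      have "good ?h' S"
        using S by (simp add: good_def legal_move_def free_elements_eq claimed)
      then have "good ?h' (maker ?h')"
        by (rule good_maker)
      then have "position_win a X F (t - Suc i) (breaker_claimed (?h' @ [maker ?h']))
          (maker_claimed (?h' @ [maker ?h']))"
        by (simp add: good_def breaker_claimed_snoc maker_claimed_snoc del: append_assoc)
      moreover have "play breaker maker (2 * Suc i) = ?h' @ [maker ?h']"
        by (simp add: Let_def)
      ultimately show ?case
        by (simp only:)
    qed
    from this[of t] show "\<exists>W\<in>F. W \<subseteq> maker_claimed (play breaker maker (2 * t))"
      by simp
  qed
  then show ?thesis
    unfolding mb_tau_def using legal by (intro Inf_lower) blast
qed

section \<open>The star factor game\<close>

text \<open>Maker copies the pair game through \<open>e\<close> and fills her move up with arbitrary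
  free edges. So \<open>N\<close> may contain more than the image of \<open>M\<close>, which only
  restricts Breaker; his edges outside the image of \<open>e\<close> count as pairs not
  taken.\<close>

lemma (in star_pairs) position_win_of_pair_win:
  assumes "finite X" "inj_on e (C0 \<times> L0)" "e ` (C0 \<times> L0) \<subseteq> X"
    and F: "\<And>f. assignment f \<Longrightarrow> open_leaves f = {} \<Longrightarrow> e ` pairs_of f \<in> F"
    and "pair_win t R M" "R = {p \<in> C0 \<times> L0. e p \<in> B}" "M \<subseteq> C0 \<times> L0" "e ` M \<subseteq> N"
  shows "position_win a X F t B N"
  using assms(5-)
proof (induction t arbitrary: R M B N)
  case 0
  then obtain f where f: "assignment f" "open_leaves f = {}" "pairs_of f \<subseteq> M"
    by auto
  have "e ` pairs_of f \<subseteq> N"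
    using f(3) 0(4) by blast
  then show ?case
    using F[OF f(1,2)] by auto
next
  case (Suc t)
  show ?case
    unfolding position_win.simps
  proof (intro allI impI)
    fix T
    assume T: "T \<subseteq> X - (B \<union> N) \<and> card T = min a (card (X - (B \<union> N)))"
    let ?T = "{p \<in> C0 \<times> L0. e p \<in> T}"
    have "card ?T \<le> card T"
      using assms(1,2) T by (intro card_inj_on_le[of e]) (auto intro: inj_on_subset finite_subset)
    then have "card ?T \<le> a"
      using T by simp
    moreover have "?T \<inter> M = {}"
      using T Suc.prems(4) by auto
    ultimately have "?T \<subseteq> C0 \<times> L0 \<and> card ?T \<le> a \<and> ?T \<inter> M = {}"
      by blast
    from Suc.prems(1)[unfolded pair_win.simps(2), rule_format, OF this]
    obtain S where S: "S \<subseteq> C0 \<times> L0" "card S \<le> a" "S \<inter> (R \<union> ?T) = {}"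
      "pair_win t (R \<union> ?T) (M \<union> S)"
      by blast
    let ?free = "X - (B \<union> T \<union> N)"
    \<comment> \<open>Edges in \<open>N\<close> are hers already, some perhaps by earlier filling,
      so only the others are claimed now.\<close>
    have sub: "e ` S - N \<subseteq> ?free"
    proof
      fix y
      assume "y \<in> e ` S - N"
      then obtain p where p: "p \<in> S" "y = e p" "y \<notin> N"
        by blast
      then have "p \<in> C0 \<times> L0" "p \<notin> R \<union> ?T"
        using S(1,3) by blast+
      then show "y \<in> ?free"
        using p Suc.prems(2) assms(3) by blast
    qed
    have fin: "finite ?free"
      using assms(1) by simp
    have "finite S"
      using S(1) by (rule finite_board)
    then have "card (e ` S - N) \<le> a"
      using S(2) card_image_le[of S e] card_mono[of "e ` S" "e ` S - N"] by simp
    then have "card (e ` S - N) \<le> min a (card ?free)"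
      using card_mono[OF fin sub] by simp
    then obtain S' where S': "e ` S - N \<subseteq> S'" "S' \<subseteq> ?free" "card S' = min a (card ?free)"
      using exists_subset_between[OF _ _ sub fin, of "min a (card ?free)"] by auto
    have "position_win a X F t (B \<union> T) (N \<union> S')"
    proof (rule Suc.IH[OF S(4)])
      show "R \<union> ?T = {p \<in> C0 \<times> L0. e p \<in> B \<union> T}"
        using Suc.prems(2) by auto
      show "M \<union> S \<subseteq> C0 \<times> L0"
        using Suc.prems(3) S(1) by blast
      show "e ` (M \<union> S) \<subseteq> N \<union> S'"
        using Suc.prems(4) S'(1) by blast
    qed
    then show "\<exists>S. S \<subseteq> ?free \<and> card S = min a (card ?free) \<and> position_win a X F t (B \<union> T) (N \<union> S)"
      using S'(2,3) by blast
  qed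
qed

lemma finite_complete_edges: "finite (complete_edges n)"
  by (simp add: complete_edges_def finite_imp_finite_nsets)

text \<open>Without open leaves there is no open centre, so every centre has exactly
  \<open>d = k - 1\<close> leaves, and the stars on the fibres partition the vertices.\<close>

lemma star_factor_of_assignment:
  assumes star_pairs: "star_pairs a d C0 L0"
    and C0: "C0 = {..<q}" and L0: "L0 = {q..<k * q}" and k: "k = Suc d"
    and f: "star_pairs.assignment d C0 L0 f" "star_pairs.open_leaves L0 f = {}"
  shows "(\<lambda>(c, l). {c, l}) ` pairs_of f \<in> star_factor_game k (k * q)"
proof -
  interpret star_pairs a d C0 L0
    by (rule star_pairs)
  define star where "star c = (insert c (fibre f c), (\<lambda>v. {c, v}) ` fibre f c)" for c
  have fibre_sub: "fibre f c \<subseteq> L0" for c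
    using f(1) by (auto simp: assignment_def fibre_def)
  have centre_notin: "c \<notin> fibre f c'" if "c \<in> C0" for c c'
    using that fibre_sub disjoint by blast
  have "open_centres f = {}"
    using card_open_centres_le[OF f(1)] f(2) by simp
  then have card_fibre: "card (fibre f c) = d" if "c \<in> C0" for c
  proof (intro antisym)
    show "card (fibre f c) \<le> d"
      using f(1) by (simp add: assignment_def)
    have "c \<notin> open_centres f"
      using \<open>open_centres f = {}\<close> by simp
    then show "d \<le> card (fibre f c)"
      using that by (simp add: open_centres_def)
  qed
  have disj: "fst (star c) \<inter> fst (star c') = {}" if "c \<in> C0" "c' \<in> C0" "c \<noteq> c'" for c c'
  proof -
    have "fibre f c \<inter> fibre f c' = {}"
      using that(3) by (auto simp: fibre_def)
    then show ?thesis
      using that centre_notin by (auto simp: star_def)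
  qed
  have "inj_on star C0"
  proof (intro inj_onI, rule ccontr)
    fix c c'
    assume "c \<in> C0" "c' \<in> C0" "star c = star c'" "c \<noteq> c'"
    then have "fst (star c) = {}"
      using disj[of c c'] by simp
    then show False
      by (simp add: star_def)
  qed
  then have "card (star ` C0) = q"
    using C0 by (simp add: card_image)
  moreover have "is_star k (star c)" if "c \<in> C0" for c
    unfolding is_star_def star_def
    using that centre_notin card_fibre finite_fibre[OF f(1)] k
    by (intro exI[of _ c] exI[of _ "fibre f c"]) auto
  moreover have "fst (star c) \<subseteq> {..<k * q}" if "c \<in> C0" for c
    using that fibre_sub[of c] k by (auto simp: star_def C0 L0)
  moreover have "snd (star c) \<subseteq> complete_edges (k * q)" if "c \<in> C0" for c
    using that fibre_sub[of c] k by (auto simp: star_def C0 L0 complete_edges_def nsets_def card_insert_if)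
  moreover have "pairwise (\<lambda>G H. disjnt (fst G) (fst H)) (star ` C0)"
    using disj by (force simp: pairwise_def disjnt_def)
  moreover have "(\<Union>G\<in>star ` C0. fst G) = {..<k * q}"
  proof -
    have "L0 \<subseteq> (\<Union>c\<in>C0. fibre f c)"
    proof
      fix l
      assume "l \<in> L0"
      then obtain c where c: "f l = Some c"
        using f(2) by (auto simp: open_leaves_def)
      moreover have "ran f \<subseteq> C0"
        using f(1) by (simp add: assignment_def)
      ultimately have "c \<in> C0"
        by (blast intro: ranI)
      then show "l \<in> (\<Union>c\<in>C0. fibre f c)"
        using c by (auto simp: fibre_def)
    qed
    moreover have "(\<Union>c\<in>C0. fibre f c) \<subseteq> L0"
      using fibre_sub by blast
    moreover have "{..<k * q} = C0 \<union> L0"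
      using k by (auto simp: C0 L0)
    ultimately show ?thesis
      by (auto simp: star_def)
  qed
  moreover have "k * q div k = q"
    using k by (metis nat.distinct(1) nonzero_mult_div_cancel_left)
  ultimately have "is_star_factor k (k * q) (star ` C0)"
    using finite_C0 unfolding is_star_factor_def by simp
  moreover have "pairs_of f = (\<Union>c\<in>C0. Pair c ` fibre f c)"
    using pairs_of_subset[OF f(1)] by (auto simp: pairs_of_def fibre_def)
  then have "(\<lambda>(c, l). {c, l}) ` pairs_of f = (\<Union>G\<in>star ` C0. snd G)"
    by (simp add: star_def image_UN image_image)
  ultimately show ?thesis
    unfolding star_factor_game_def by blast
qed

lemma mb_tau_star_factor_le:
  assumes "1 \<le> a" "3 \<le> k" "1000 * (a * k) \<le> q"
  shows "mb_tau a (complete_edges (k * q)) (star_factor_game k (k * q)) \<le> enat ((k - 1) * q div a + 1)"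
proof -
  let ?L = "{q..<k * q}" and ?e = "\<lambda>(c, l). {c, l}"
  have card_L: "card ?L = (k - 1) * q"
    by (simp add: diff_mult_distrib)
  interpret star_pairs a "k - 1" "{..<q}" ?L
    using assms card_L by unfold_locales auto
  have "1000 * (a * (k - 1)) \<le> 1000 * (a * k)"
    by simp
  then have "1000 * (a * (k - 1)) \<le> q"
    using assms(3) by (rule order_trans)
  then have "pair_win ((k - 1) * q div a + 1) {} {}"
    using pair_win_initial unfolding card_L by simp
  \<comment> \<open>Centres are smaller than leaves, so an edge determines its ordered pair.\<close>
  moreover have "inj_on ?e ({..<q} \<times> ?L)"
    by (auto simp: inj_on_def doubleton_eq_iff)
  moreover have "?e ` ({..<q} \<times> ?L) \<subseteq> complete_edges (k * q)"
    by (auto simp: complete_edges_def nsets_def card_insert_if)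
  moreover have "?e ` pairs_of f \<in> star_factor_game k (k * q)"
    if "assignment f" "open_leaves f = {}" for f
    using star_factor_of_assignment[OF star_pairs_axioms refl refl _ that] assms(2) by simp
  ultimately have "position_win a (complete_edges (k * q)) (star_factor_game k (k * q))
      ((k - 1) * q div a + 1) {} {}"
    using position_win_of_pair_win[OF finite_complete_edges, of ?e "k * q" "star_factor_game k (k * q)" _ "{}" "{}" "{}" "{}"]
    by (simp del: pair_win.simps position_win.simps)
  then show ?thesis
    by (rule mb_tau_le[OF finite_complete_edges])
qed

section \<open>Arithmetic of the bound\<close>

lemma ceiling_divide_not_dvd:
  fixes a m :: nat
  assumes "1 \<le> a" "\<not> a dvd m"
  shows "nat \<lceil>real m / real a\<rceil> = m div a + 1"
proof -
  have "m mod a \<noteq> 0"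
    using assms(2) by (simp add: dvd_eq_mod_eq_0)
  have "\<lceil>real m / real a\<rceil> = int (m div a + 1)"
  proof (rule ceiling_unique)
    have "a * (m div a) < m"
      using \<open>m mod a \<noteq> 0\<close> mult_div_mod_eq[of a m] by linarith
    then have "real (m div a) * real a < real m"
      by (metis mult.commute of_nat_less_iff of_nat_mult)
    then show "real_of_int (int (m div a + 1)) - 1 < real m / real a"
      using assms(1) by (simp add: pos_less_divide_eq)
    have "m < a * (m div a + 1)"
      using assms(1) dividend_less_times_div[of a m] by simp
    then have "real m \<le> real (m div a + 1) * real a"
      by (metis less_imp_le mult.commute of_nat_le_iff of_nat_mult)
    then show "real m / real a \<le> real_of_int (int (m div a + 1))"
      using assms(1) by (simp add: pos_divide_le_eq)
  qed
  then show ?thesis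
    by simp
qed

theorem theorem1p4:
  fixes a k :: nat
  assumes "a \<ge> 1" and "k \<ge> 3"
  shows "\<exists>n0::nat. \<forall>n\<ge>n0. k dvd n \<longrightarrow>
    mb_tau a (complete_edges n) (star_factor_game k n)
      \<le> (if \<not> a dvd ((k - 1) * n div k)
          then enat (nat \<lceil>real ((k - 1) * n) / real (k * a)\<rceil>)
          else enat ((k - 1) * n div (k * a) + 1))"
proof (intro exI[of _ "k * (1000 * (a * k))"] allI impI)
  fix n
  assume "k * (1000 * (a * k)) \<le> n" "k dvd n"
  then obtain q where n: "n = k * q" and q: "1000 * (a * k) \<le> q"
    using assms(2) by (auto elim!: dvdE)
  have "(k - 1) * n = k * ((k - 1) * q)"
    by (simp add: n)
  then have eqs: "(k - 1) * n div k = (k - 1) * q" "(k - 1) * n div (k * a) = (k - 1) * q div a"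
    "real ((k - 1) * n) / real (k * a) = real ((k - 1) * q) / real a"
    using assms(2) by (simp_all only: of_nat_mult, auto)
  have bound: "mb_tau a (complete_edges n) (star_factor_game k n) \<le> enat ((k - 1) * q div a + 1)"
    unfolding n using mb_tau_star_factor_le[OF assms q] .
  show "mb_tau a (complete_edges n) (star_factor_game k n)
      \<le> (if \<not> a dvd ((k - 1) * n div k)
          then enat (nat \<lceil>real ((k - 1) * n) / real (k * a)\<rceil>)
          else enat ((k - 1) * n div (k * a) + 1))"
  \<comment> \<open>Both branches of the bound equal \<open>(k - 1) * q div a + 1\<close>.\<close>
  proof (cases "a dvd (k - 1) * q")
    case True
    then show ?thesis
      using bound by (simp only: eqs not_True_eq_False if_False)
  next
    case False
    then show ?thesis
      using bound by (simp only: eqs ceiling_divide_not_dvd[OF assms(1) False] not_False_eq_True if_True)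
  qed
qed

end
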